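(* Let $g_1,\dots,g_m\in\mathbb{R}[x]=\mathbb{R}[x_1,\dots,x_n]$ and suppose $S=\{x\in\mathbb{R}^n:\ g_1(x)\ge 0,\dots,g_m(x)\ge 0\}$ is compact, convex and has nonempty interior. If each $g_i$ is either sos-concave or strictly quasi-concave on $S$, then $S$ is SDP representable.
   Context: SDP representable: a set $S\subseteq\mathbb{R}^n$ is SDP representable if there exist an integer $N\ge 0$ and real symmetric matrices $F_0,F_1,\dots,F_n,G_1,\dots,G_N$ of a common size such that $S=\{x\in\mathbb{R}^n:\ \exists\, y\in\mathbb{R}^N,\ F_0+\sum_{i=1}^n x_iF_i+\sum_{j=1}^N y_jG_j\succeq 0\}$, where $\succeq 0$ means positive semidefinite. A symmetric matrix polynomial $P(x)\in\mathbb{R}[x]^{r\times r}$ is SOS if $P(x)=W(x)^TW(x)$ for some (possibly nonsquare) matrix polynomial $W(x)$ with $r$ columns. A polynomial $g$ is sos-concave if $-\nabla^2g(x)$ is SOS. A polynomial $g$ is strictly quasi-concave on $S$ if for every $x\in S$ and every $0\neq v\in\mathbb{R}^n$ with $v^T\nabla g(x)=0$ one has $-v^T\nabla^2g(x)v>0$ (if $\nabla g(x)=0$ this is required for all $v\ne0$). *)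

theory Defs
  imports "HOL-Analysis.Analysis"
begin

text \<open>
  Polynomials in \<^term>\<open>CARD('n)\<close> real variables are identified with the functions on
  \<^typ>\<open>real ^ 'n\<close> that they induce, i.e. with \<^const>\<open>real_polynomial_function\<close>; as the reals
  are infinite, no information is lost, and identities of polynomials are pointwise identities.
\<close>

definition partial_deriv :: "'n \<Rightarrow> (real ^ 'n \<Rightarrow> real) \<Rightarrow> real ^ 'n \<Rightarrow> real" where
  "partial_deriv i f x = deriv (\<lambda>t. f (x + t *\<^sub>R axis i 1)) 0"

definition gradient :: "(real ^ 'n \<Rightarrow> real) \<Rightarrow> real ^ 'n \<Rightarrow> real ^ 'n" where
  "gradient f x = (\<chi> i. partial_deriv i f x)"

definition hessian :: "(real ^ 'n \<Rightarrow> real) \<Rightarrow> real ^ 'n \<Rightarrow> real ^ 'n ^ 'n" where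
  "hessian f x = (\<chi> i j. partial_deriv i (partial_deriv j f) x)"

text \<open>
  The number \<open>k\<close> of rows of the factor \<open>W\<close> is arbitrary, so \<open>W\<close> is given by its entries
  \<open>W l a\<close> with row index \<open>l < k\<close> and column index \<open>a\<close>.
\<close>

definition sos_matrix :: "(real ^ 'n \<Rightarrow> real ^ 'r ^ 'r) \<Rightarrow> bool" where
  "sos_matrix P \<longleftrightarrow>
    (\<exists>(k::nat) (W :: nat \<Rightarrow> 'r \<Rightarrow> real ^ 'n \<Rightarrow> real).
      (\<forall>l<k. \<forall>a. real_polynomial_function (W l a)) \<and>
      (\<forall>x a b. P x $ a $ b = (\<Sum>l<k. W l a x * W l b x)))"

definition sos_concave :: "(real ^ 'n \<Rightarrow> real) \<Rightarrow> bool" where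
  "sos_concave g \<longleftrightarrow> sos_matrix (\<lambda>x. - hessian g x)"

definition strictly_quasi_concave_on :: "(real ^ 'n) set \<Rightarrow> (real ^ 'n \<Rightarrow> real) \<Rightarrow> bool" where
  "strictly_quasi_concave_on S g \<longleftrightarrow>
    (\<forall>x\<in>S. \<forall>v. v \<noteq> 0 \<and> v \<bullet> gradient g x = 0 \<longrightarrow> - (v \<bullet> (hessian g x *v v)) > 0)"

text \<open>
  The size of the matrices in a linear matrix inequality is existentially quantified, so it cannot
  be a type.  An \<open>r \<times> r\<close> matrix is a function of two indices below \<open>r\<close>; values at other indices
  are never used.
\<close>

definition symmetric_upto :: "nat \<Rightarrow> (nat \<Rightarrow> nat \<Rightarrow> real) \<Rightarrow> bool" where
  "symmetric_upto r A \<longleftrightarrow> (\<forall>a<r. \<forall>b<r. A a b = A b a)"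

definition psd_upto :: "nat \<Rightarrow> (nat \<Rightarrow> nat \<Rightarrow> real) \<Rightarrow> bool" where
  "psd_upto r A \<longleftrightarrow>
    symmetric_upto r A \<and> (\<forall>v :: nat \<Rightarrow> real. (\<Sum>a<r. \<Sum>b<r. v a * A a b * v b) \<ge> 0)"

definition sdp_representable :: "(real ^ 'n) set \<Rightarrow> bool" where
  "sdp_representable S \<longleftrightarrow>
    (\<exists>(N::nat) (r::nat) (F0 :: nat \<Rightarrow> nat \<Rightarrow> real) (F :: 'n \<Rightarrow> nat \<Rightarrow> nat \<Rightarrow> real)
       (G :: nat \<Rightarrow> nat \<Rightarrow> nat \<Rightarrow> real).
      symmetric_upto r F0 \<and> (\<forall>i. symmetric_upto r (F i)) \<and> (\<forall>j<N. symmetric_upto r (G j)) \<and>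
      S = {x. \<exists>y :: nat \<Rightarrow> real.
        psd_upto r (\<lambda>a b. F0 a b + (\<Sum>i\<in>UNIV. x $ i * F i a b) + (\<Sum>j<N. y j * G j a b))})"

end

theory Submission
  imports Defs
begin

text \<open>
  A compact convex set is covered by finitely many pieces cut out near points \<open>p \<in> S\<close>; since lifted
  linear matrix inequalities can be homogenized, the set of all convex combinations of points of two
  bounded representable sets is representable, so it suffices to represent the set
  \<open>{x. g x \<ge> 0}\<close> near \<open>p\<close> for each \<open>g = g\<^sub>i\<close>.

  Points \<open>x\<close> are lifted to finitely supported signed measures \<open>y\<close> of mass \<open>1\<close> with barycentre \<open>x\<close>,
  subject to \<open>\<integral>g dy \<ge> 0\<close> and to \<open>\<integral>w \<psi>\<^sup>2 dy \<ge> 0\<close> for finitely many weights \<open>w\<close> and all \<open>\<psi>\<close> in a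
  finite-dimensional space.  The lift is exact as soon as Jensen's inequality \<open>\<integral>g dy \<le> g x\<close> holds,
  which follows if \<open>s \<mapsto> \<integral>g (x + s (t - x)) dy(t)\<close> is concave on \<open>[0, 1]\<close>.  For sos-concave \<open>g\<close> the
  weight \<open>w = 1\<close> suffices.  For strictly quasi-concave \<open>g\<close> with \<open>g p = 0\<close>, replace \<open>g\<close> by
  \<open>g - (M / 2) g\<^sup>2\<close>, whose Hessian at \<open>p\<close> is negative definite; near \<open>p\<close> its deviation from a
  constant matrix is absorbed by weights \<open>\<eta> \<plusminus> (f - f p)\<close>.
\<close>

section \<open>Lifted linear matrix inequalities\<close>

definition affine_in :: "'j set \<Rightarrow> (real ^ 'n \<Rightarrow> ('j \<Rightarrow> real) \<Rightarrow> real) \<Rightarrow> bool" where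
  "affine_in J f \<longleftrightarrow>
    (\<exists>c a b. \<forall>x y. f x y = c + (\<Sum>i\<in>UNIV. x $ i * a i) + (\<Sum>j\<in>J. y j * b j))"

lemma affine_in_const: "affine_in J (\<lambda>x y. c)"
  unfolding affine_in_def
  by (intro exI[of _ c] exI[of _ "\<lambda>_. 0"]) simp

lemma affine_in_coord: "affine_in J (\<lambda>x y. x $ i)"
  unfolding affine_in_def
  by (intro exI[of _ 0] exI[of _ "\<lambda>k. if k = i then 1 else 0"] exI[of _ "\<lambda>_. 0"])
    (simp add: sum.delta if_distrib cong: if_cong)

lemma affine_in_var:
  assumes "finite J" "j \<in> J"
  shows "affine_in J (\<lambda>x y. y j)"
  unfolding affine_in_def
  by (intro exI[of _ 0] exI[of _ "\<lambda>_. 0"] exI[of _ "\<lambda>k. if k = j then 1 else 0"])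
    (simp add: assms sum.delta if_distrib cong: if_cong)

lemma affine_in_add:
  assumes "affine_in J f" "affine_in J g"
  shows "affine_in J (\<lambda>x y. f x y + g x y)"
proof -
  obtain c a b where f: "\<And>x y. f x y = c + (\<Sum>i\<in>UNIV. x $ i * a i) + (\<Sum>j\<in>J. y j * b j)"
    using assms(1) unfolding affine_in_def by auto
  obtain c' a' b' where g: "\<And>x y. g x y = c' + (\<Sum>i\<in>UNIV. x $ i * a' i) + (\<Sum>j\<in>J. y j * b' j)"
    using assms(2) unfolding affine_in_def by auto
  show ?thesis
    unfolding affine_in_def
    by (intro exI[of _ "c + c'"] exI[of _ "\<lambda>i. a i + a' i"] exI[of _ "\<lambda>j. b j + b' j"])
      (simp add: f g ring_distribs sum.distrib)
qed

lemma affine_in_mult_right: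
  assumes "affine_in J f"
  shows "affine_in J (\<lambda>x y. f x y * d)"
proof -
  obtain c a b where f: "\<And>x y. f x y = c + (\<Sum>i\<in>UNIV. x $ i * a i) + (\<Sum>j\<in>J. y j * b j)"
    using assms unfolding affine_in_def by auto
  show ?thesis
    unfolding affine_in_def
    by (intro exI[of _ "c * d"] exI[of _ "\<lambda>i. a i * d"] exI[of _ "\<lambda>j. b j * d"])
      (simp add: f ring_distribs sum_distrib_right mult.assoc)
qed

lemma affine_in_mult_left:
  assumes "affine_in J f"
  shows "affine_in J (\<lambda>x y. d * f x y)"
  using affine_in_mult_right[OF assms, of d] by (simp add: mult.commute)

lemma affine_in_uminus: "affine_in J f \<Longrightarrow> affine_in J (\<lambda>x y. - f x y)"
  using affine_in_mult_left[of J f "-1"] by simp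

lemma affine_in_diff: "affine_in J f \<Longrightarrow> affine_in J g \<Longrightarrow> affine_in J (\<lambda>x y. f x y - g x y)"
  using affine_in_add[of J f "\<lambda>x y. - g x y"] by (simp add: affine_in_uminus)

lemma affine_in_sum:
  assumes "\<And>k. k \<in> K \<Longrightarrow> affine_in J (f k)"
  shows "affine_in J (\<lambda>x y. \<Sum>k\<in>K. f k x y)"
  using assms
proof (induction K rule: infinite_finite_induct)
  case (insert k K)
  then show ?case by (simp add: affine_in_add)
qed (simp_all add: affine_in_const)

lemmas affine_in_intros = affine_in_const affine_in_coord affine_in_var affine_in_add
  affine_in_mult_right affine_in_mult_left affine_in_uminus affine_in_diff affine_in_sum

lemma affine_in_subst:
  assumes f: "affine_in J f"
    and X: "\<And>i. affine_in J' (\<lambda>x y. X x y $ i)"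
    and Y: "\<And>j. j \<in> J \<Longrightarrow> affine_in J' (\<lambda>x y. Y x y j)"
  shows "affine_in J' (\<lambda>x y. f (X x y) (Y x y))"
proof -
  obtain c a b where f: "\<And>x y. f x y = c + (\<Sum>i\<in>UNIV. x $ i * a i) + (\<Sum>j\<in>J. y j * b j)"
    using f unfolding affine_in_def by auto
  show ?thesis
    unfolding f by (intro affine_in_intros X Y)
qed

definition lmi :: "'j set \<Rightarrow> (real ^ 'n \<Rightarrow> ('j \<Rightarrow> real) \<Rightarrow> bool) \<Rightarrow> bool" where
  "lmi J P \<longleftrightarrow>
    (\<exists>r A. (\<forall>a b. affine_in J (A a b)) \<and> (\<forall>a<r. \<forall>b<r. A a b = A b a) \<and>
      (\<forall>x y. P x y \<longleftrightarrow> psd_upto r (\<lambda>a b. A a b x y)))"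

lemma lmiE:
  assumes "lmi J P"
  obtains r A where "\<And>a b. affine_in J (A a b)" "\<And>a b. a < r \<Longrightarrow> b < r \<Longrightarrow> A a b = A b a"
    "\<And>x y. P x y \<longleftrightarrow> psd_upto r (\<lambda>a b. A a b x y)"
  using assms unfolding lmi_def by blast

lemma lmi_psd:
  assumes "\<And>a b. affine_in J (A a b)" "\<And>a b. a < r \<Longrightarrow> b < r \<Longrightarrow> A a b = A b a"
  shows "lmi J (\<lambda>x y. psd_upto r (\<lambda>a b. A a b x y))"
  unfolding lmi_def using assms by blast

lemma psd_upto_1: "psd_upto (Suc 0) A \<longleftrightarrow> A 0 0 \<ge> 0"
proof -
  have "(\<forall>v::nat\<Rightarrow>real. v 0 * A 0 0 * v 0 \<ge> 0) \<longleftrightarrow> A 0 0 \<ge> 0"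
  proof
    assume "\<forall>v::nat\<Rightarrow>real. v 0 * A 0 0 * v 0 \<ge> 0"
    from this[rule_format, of "\<lambda>_. 1"] show "A 0 0 \<ge> 0" by simp
  next
    assume "A 0 0 \<ge> 0"
    then show "\<forall>v::nat\<Rightarrow>real. v 0 * A 0 0 * v 0 \<ge> 0"
      by (metis mult.assoc mult.commute mult_nonneg_nonneg zero_le_square)
  qed
  then show ?thesis
    by (simp add: psd_upto_def symmetric_upto_def)
qed

lemma lmi_nonneg:
  assumes "affine_in J f"
  shows "lmi J (\<lambda>x y. f x y \<ge> 0)"
  using lmi_psd[of J "\<lambda>_ _. f" "Suc 0"] assms by (simp add: psd_upto_1)

lemma sum_lessThan_add:
  fixes f :: "nat \<Rightarrow> 'a::comm_monoid_add"
  shows "(\<Sum>a<m+n. f a) = (\<Sum>a<m. f a) + (\<Sum>a<n. f (m + a))"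
  by (induction n) (simp_all add: add.assoc)

lemma psd_upto_block:
  fixes A B :: "nat \<Rightarrow> nat \<Rightarrow> real" and m n :: nat
  defines "C \<equiv> \<lambda>a b. if a < m \<and> b < m then A a b
      else if m \<le> a \<and> m \<le> b then B (a - m) (b - m) else 0"
  shows "psd_upto (m + n) C \<longleftrightarrow> psd_upto m A \<and> psd_upto n B"
proof -
  have sum: "(\<Sum>a<m+n. \<Sum>b<m+n. v a * C a b * v b) =
      (\<Sum>a<m. \<Sum>b<m. v a * A a b * v b) + (\<Sum>a<n. \<Sum>b<n. v (m + a) * B a b * v (m + b))"
    for v :: "nat \<Rightarrow> real"
    by (simp add: sum_lessThan_add C_def)
  have sym: "symmetric_upto (m + n) C \<longleftrightarrow> symmetric_upto m A \<and> symmetric_upto n B"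
  proof
    assume l: "symmetric_upto (m + n) C"
    have "A a b = A b a" if "a < m" "b < m" for a b
      using l[unfolded symmetric_upto_def, rule_format, of a b] that by (simp add: C_def)
    moreover have "B a b = B b a" if "a < n" "b < n" for a b
      using l[unfolded symmetric_upto_def, rule_format, of "m + a" "m + b"] that by (simp add: C_def)
    ultimately show "symmetric_upto m A \<and> symmetric_upto n B"
      by (simp add: symmetric_upto_def)
  next
    assume r: "symmetric_upto m A \<and> symmetric_upto n B"
    show "symmetric_upto (m + n) C"
      using r unfolding symmetric_upto_def C_def by auto
  qed
  show ?thesis
  proof
    assume l: "psd_upto (m + n) C"
    have "(\<Sum>a<m. \<Sum>b<m. v a * A a b * v b) \<ge> 0" for v
    proof -
      let ?v = "\<lambda>a. if a < m then v a else 0"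
      have "(\<Sum>a<m+n. \<Sum>b<m+n. ?v a * C a b * ?v b) \<ge> 0"
        using l by (simp only: psd_upto_def)
      then show ?thesis by (simp only: sum) simp
    qed
    moreover have "(\<Sum>a<n. \<Sum>b<n. v a * B a b * v b) \<ge> 0" for v
    proof -
      let ?v = "\<lambda>a. if a < m then 0 else v (a - m)"
      have "(\<Sum>a<m+n. \<Sum>b<m+n. ?v a * C a b * ?v b) \<ge> 0"
        using l by (simp only: psd_upto_def)
      then show ?thesis by (simp only: sum) simp
    qed
    ultimately show "psd_upto m A \<and> psd_upto n B"
      using l sym by (simp add: psd_upto_def)
  next
    assume "psd_upto m A \<and> psd_upto n B"
    then show "psd_upto (m + n) C"
      unfolding psd_upto_def sum sym by (simp add: add_nonneg_nonneg)
  qed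
qed

lemma lmi_conj:
  assumes "lmi J P" "lmi J Q"
  shows "lmi J (\<lambda>x y. P x y \<and> Q x y)"
proof -
  obtain m A where A: "\<And>a b. affine_in J (A a b)" "\<And>a b. a < m \<Longrightarrow> b < m \<Longrightarrow> A a b = A b a"
    "\<And>x y. P x y \<longleftrightarrow> psd_upto m (\<lambda>a b. A a b x y)"
    using assms(1) by (rule lmiE) blast
  obtain n B where B: "\<And>a b. affine_in J (B a b)" "\<And>a b. a < n \<Longrightarrow> b < n \<Longrightarrow> B a b = B b a"
    "\<And>x y. Q x y \<longleftrightarrow> psd_upto n (\<lambda>a b. B a b x y)"
    using assms(2) by (rule lmiE) blast
  let ?C = "\<lambda>a b. if a < m \<and> b < m then A a b
      else if m \<le> a \<and> m \<le> b then B (a - m) (b - m) else (\<lambda>x y. 0)"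
  have "lmi J (\<lambda>x y. psd_upto (m + n) (\<lambda>a b. ?C a b x y))"
  proof (rule lmi_psd)
    show "affine_in J (?C a b)" for a b
      by (simp add: A(1) B(1) affine_in_const)
    show "?C a b = ?C b a" if "a < m + n" "b < m + n" for a b
      using that A(2)[of a b] B(2)[of "a - m" "b - m"] by auto
  qed
  moreover have "psd_upto (m + n) (\<lambda>a b. ?C a b x y) \<longleftrightarrow> P x y \<and> Q x y" for x y
    unfolding A(3) B(3)
    using psd_upto_block[of m n "\<lambda>a b. A a b x y" "\<lambda>a b. B a b x y"]
    by (simp add: if_distrib[of "\<lambda>f. f x y"] cong: if_cong)
  ultimately show ?thesis by simp
qed

lemma lmi_True: "lmi J (\<lambda>x y. True)"
  using lmi_nonneg[OF affine_in_const[of J 0]] by simp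

lemma lmi_eq:
  assumes "affine_in J f" "affine_in J g"
  shows "lmi J (\<lambda>x y. f x y = g x y)"
proof -
  have "lmi J (\<lambda>x y. f x y - g x y \<ge> 0 \<and> g x y - f x y \<ge> 0)"
    by (intro lmi_conj lmi_nonneg affine_in_diff assms)
  moreover have "f x y - g x y \<ge> 0 \<and> g x y - f x y \<ge> 0 \<longleftrightarrow> f x y = g x y" for x y
    by auto
  ultimately show ?thesis by simp
qed

lemma lmi_ball:
  assumes "finite K" "\<And>k. k \<in> K \<Longrightarrow> lmi J (P k)"
  shows "lmi J (\<lambda>x y. \<forall>k\<in>K. P k x y)"
  using assms
  by (induction K rule: finite_induct) (simp_all add: lmi_True lmi_conj)

lemma lmi_subst:
  assumes "lmi J P"
    and "\<And>i. affine_in J' (\<lambda>x y. X x y $ i)"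
    and "\<And>j. j \<in> J \<Longrightarrow> affine_in J' (\<lambda>x y. Y x y j)"
  shows "lmi J' (\<lambda>x y. P (X x y) (Y x y))"
proof -
  obtain m A where A: "\<And>a b. affine_in J (A a b)" "\<And>a b. a < m \<Longrightarrow> b < m \<Longrightarrow> A a b = A b a"
    "\<And>x y. P x y \<longleftrightarrow> psd_upto m (\<lambda>a b. A a b x y)"
    using assms(1) by (rule lmiE) blast
  show ?thesis
    unfolding A(3)
    by (rule lmi_psd) (auto intro: affine_in_subst[OF A(1) assms(2,3)] simp: A(2))
qed

lemma sdp_representableI:
  fixes S :: "(real ^ 'n) set"
  assumes "finite J" and P: "lmi J P" and S: "S = {x. \<exists>y. P x y}"
  shows "sdp_representable S"
proof -
  obtain r A where A: "\<And>a b. affine_in J (A a b)" "\<And>a b. a < r \<Longrightarrow> b < r \<Longrightarrow> A a b = A b a"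
    "\<And>x y. P x y \<longleftrightarrow> psd_upto r (\<lambda>a b. A a b x y)"
    using P by (rule lmiE) blast
  have "\<forall>f. \<exists>c a b. affine_in J f \<longrightarrow>
      (\<forall>(x::real^'n) y. f x y = c + (\<Sum>i\<in>UNIV. x $ i * a i) + (\<Sum>j\<in>J. y j * b j))"
    unfolding affine_in_def by blast
  then obtain c a b where cab: "\<And>f (x::real^'n) y. affine_in J f \<Longrightarrow>
      f x y = c f + (\<Sum>i\<in>UNIV. x $ i * a f i) + (\<Sum>j\<in>J. y j * b f j)"
    by metis
  obtain e where e: "bij_betw e {..<card J} J"
    using ex_bij_betw_nat_finite[OF \<open>finite J\<close>] by (auto simp: lessThan_atLeast0)
  define F0 where "F0 k l = c (A k l)" for k l
  define F where "F i k l = a (A k l) i" for i k l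
  define G where "G j k l = b (A k l) (e j)" for j k l
  have "A k l x y = F0 k l + (\<Sum>i\<in>UNIV. x $ i * F i k l) + (\<Sum>j<card J. y (e j) * G j k l)" for k l x y
    using cab[OF A(1)[of k l], of x y] sum.reindex_bij_betw[OF e, of "\<lambda>j. y j * b (A k l) j"]
    by (simp only: F0_def F_def G_def)
  then have P: "P x y \<longleftrightarrow> psd_upto r (\<lambda>k l. F0 k l + (\<Sum>i\<in>UNIV. x $ i * F i k l) + (\<Sum>j<card J. y (e j) * G j k l))" for x y
    unfolding A(3) by simp
  have "S = {x. \<exists>y :: nat \<Rightarrow> real.
        psd_upto r (\<lambda>k l. F0 k l + (\<Sum>i\<in>UNIV. x $ i * F i k l) + (\<Sum>j<card J. y j * G j k l))}"
    (is "S = {x. \<exists>y. ?Q x y}")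
  proof (intro equalityI subsetI)
    fix x assume "x \<in> S"
    then obtain y where "?Q x (\<lambda>j. y (e j))" unfolding S P by blast
    then show "x \<in> {x. \<exists>y. ?Q x y}" by (intro CollectI exI[of _ "\<lambda>j. y (e j)"])
  next
    fix x assume "x \<in> {x. \<exists>y. ?Q x y}"
    then obtain y where y: "?Q x y" by blast
    have "y j = y (the_inv_into {..<card J} e (e j))" if "j < card J" for j
      using e that by (simp add: bij_betw_def the_inv_into_f_f)
    then have "?Q x (\<lambda>j. y (the_inv_into {..<card J} e (e j)))"
      using y by (simp cong: sum.cong_simp)
    then have "P x (\<lambda>j. y (the_inv_into {..<card J} e j))" unfolding P .
    then show "x \<in> S" unfolding S by blast
  qed
  moreover have "symmetric_upto r F0" "\<forall>i. symmetric_upto r (F i)" "\<forall>j<card J. symmetric_upto r (G j)"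
    using A(2) by (simp_all add: symmetric_upto_def F0_def F_def G_def)
  ultimately show ?thesis
    unfolding sdp_representable_def by blast
qed

lemma sdp_representableE:
  assumes "sdp_representable S"
  obtains N :: nat and P where "lmi {..<N} P" "S = {x. \<exists>y. P x y}"
proof -
  obtain N :: nat and r F0 F G where sym: "symmetric_upto r F0" "\<forall>i. symmetric_upto r (F i)" "\<forall>j<N. symmetric_upto r (G j)"
    and S: "S = {x. \<exists>y :: nat \<Rightarrow> real.
        psd_upto r (\<lambda>a b. F0 a b + (\<Sum>i\<in>UNIV. x $ i * F i a b) + (\<Sum>j<N. y j * G j a b))}"
    using assms unfolding sdp_representable_def by blast
  have "lmi {..<N} (\<lambda>x y. psd_upto r (\<lambda>a b. F0 a b + (\<Sum>i\<in>UNIV. x $ i * F i a b) + (\<Sum>j<N. y j * G j a b)))"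
    by (rule lmi_psd) (use sym in \<open>auto intro!: affine_in_intros simp: symmetric_upto_def\<close>)
  with S show thesis using that by blast
qed

lemma sdp_representable_lmi:
  assumes "lmi ({} :: nat set) (\<lambda>x y. P x)"
  shows "sdp_representable {x. P x}"
  using sdp_representableI[OF _ assms] by simp

lemma sdp_representable_UNIV: "sdp_representable UNIV"
  using sdp_representable_lmi[OF lmi_True] by simp

lemma sdp_representable_box:
  fixes p :: "real ^ 'n"
  shows "sdp_representable {x. \<forall>i. \<bar>x $ i - p $ i\<bar> \<le> d}"
proof -
  have "lmi ({}::nat set) (\<lambda>(x::real^'n) y. \<forall>i\<in>UNIV. d - (x $ i - p $ i) \<ge> 0 \<and> d + (x $ i - p $ i) \<ge> 0)"
    by (intro lmi_ball lmi_conj lmi_nonneg affine_in_intros) auto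
  from sdp_representable_lmi[OF this] show ?thesis
    by (rule back_subst[of sdp_representable]) (auto simp: abs_le_iff algebra_simps)
qed

lemma sdp_representable_Int:
  assumes "sdp_representable S" "sdp_representable T"
  shows "sdp_representable (S \<inter> T)"
proof -
  obtain M :: nat and P where P: "lmi {..<M} P" "S = {x. \<exists>y. P x y}"
    using assms(1) by (rule sdp_representableE)
  obtain N :: nat and Q where Q: "lmi {..<N} Q" "T = {x. \<exists>y. Q x y}"
    using assms(2) by (rule sdp_representableE)
  let ?J = "{..<M} <+> {..<N}"
  have "lmi ?J (\<lambda>x y. P x (\<lambda>j. y (Inl j)) \<and> Q x (\<lambda>j. y (Inr j)))"
    by (intro lmi_conj lmi_subst[OF P(1)] lmi_subst[OF Q(1)] affine_in_intros) auto
  then show ?thesis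
  proof (rule sdp_representableI[rotated])
    show "S \<inter> T = {x. \<exists>y. P x (\<lambda>j. y (Inl j)) \<and> Q x (\<lambda>j. y (Inr j))}" (is "_ = ?R")
    proof safe
      fix x assume "x \<in> S" "x \<in> T"
      then obtain y z where "P x y" "Q x z" using P(2) Q(2) by auto
      then show "\<exists>y. P x (\<lambda>j. y (Inl j)) \<and> Q x (\<lambda>j. y (Inr j))"
        by (intro exI[of _ "case_sum y z"]) simp
    qed (auto simp: P(2) Q(2))
  qed auto
qed

lemma sdp_representable_INT:
  assumes "finite K" "\<And>k. k \<in> K \<Longrightarrow> sdp_representable (S k)"
  shows "sdp_representable (\<Inter>k\<in>K. S k)"
  using assms
  by (induction K rule: finite_induct) (simp_all add: sdp_representable_UNIV sdp_representable_Int)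

lemma psd_upto_scale:
  assumes "psd_upto r A" "c \<ge> 0"
  shows "psd_upto r (\<lambda>a b. c * A a b)"
proof -
  have "(\<Sum>a<r. \<Sum>b<r. v a * (c * A a b) * v b) = c * (\<Sum>a<r. \<Sum>b<r. v a * A a b * v b)" for v
    by (simp add: sum_distrib_left mult_ac)
  then show ?thesis
    using assms by (simp add: psd_upto_def symmetric_upto_def)
qed

lemma psd_upto_add:
  assumes "psd_upto r A" "psd_upto r B"
  shows "psd_upto r (\<lambda>a b. A a b + B a b)"
proof -
  have "(\<Sum>a<r. \<Sum>b<r. v a * (A a b + B a b) * v b) =
      (\<Sum>a<r. \<Sum>b<r. v a * A a b * v b) + (\<Sum>a<r. \<Sum>b<r. v a * B a b * v b)" for v
    by (simp add: ring_distribs sum.distrib)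
  then show ?thesis
    using assms by (simp add: psd_upto_def symmetric_upto_def)
qed

lemma sdp_representable_join:
  fixes S T :: "(real ^ 'n) set"
  assumes "sdp_representable S" "sdp_representable T"
    and "bounded S" "bounded T" "S \<noteq> {}" "T \<noteq> {}"
  shows "sdp_representable {c *\<^sub>R s + (1 - c) *\<^sub>R t | c s t. 0 \<le> c \<and> c \<le> 1 \<and> s \<in> S \<and> t \<in> T}"
proof -
  define pencil where "pencil F0 F G N l x y a b =
      l * F0 a b + (\<Sum>i\<in>UNIV. x $ i * F i a b) + (\<Sum>j<N. y j * G j a b)"
    for F0 :: "nat \<Rightarrow> nat \<Rightarrow> real" and F :: "'n \<Rightarrow> nat \<Rightarrow> nat \<Rightarrow> real" and G :: "nat \<Rightarrow> nat \<Rightarrow> nat \<Rightarrow> real"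
      and N :: nat and l :: real and x :: "real ^ 'n" and y :: "nat \<Rightarrow> real" and a b :: nat
  have pencil_scale: "pencil F0 F G N (c * l) (c *\<^sub>R x) (\<lambda>j. c * y j) = (\<lambda>a b. c * pencil F0 F G N l x y a b)"
    for F0 F G N c l x y
    by (intro ext) (simp add: pencil_def sum_distrib_left ring_distribs mult.assoc)
  have pencil_add: "pencil F0 F G N (l + l') (x + x') (\<lambda>j. y j + y' j) =
      (\<lambda>a b. pencil F0 F G N l x y a b + pencil F0 F G N l' x' y' a b)"
    for F0 F G N l l' x x' y y'
    by (intro ext) (simp add: pencil_def sum.distrib ring_distribs)
  have recession: "x = 0"
    if "bounded R" "R \<noteq> {}" and R: "R = {x. \<exists>y. psd_upto r (pencil F0 F G N 1 x y)}"
      and x: "psd_upto r (pencil F0 F G N 0 x y)"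
    for R r F0 F G N x y
  proof (rule ccontr)
    assume "x \<noteq> 0"
    obtain x0 y0 where "x0 \<in> R" and 0: "psd_upto r (pencil F0 F G N 1 x0 y0)"
      using \<open>R \<noteq> {}\<close> unfolding R by blast
    obtain K where K: "\<And>z. z \<in> R \<Longrightarrow> norm z \<le> K"
      using \<open>bounded R\<close> by (auto simp: bounded_iff)
    have K0: "K \<ge> 0" using K[OF \<open>x0 \<in> R\<close>] norm_ge_zero[of x0] by linarith
    define c where "c = (2 * K + 1) / norm x"
    have "c \<ge> 0" using K0 by (simp add: c_def)
    have "psd_upto r (pencil F0 F G N (1 + c * 0) (x0 + c *\<^sub>R x) (\<lambda>j. y0 j + c * y j))"
      unfolding pencil_add pencil_scale
      by (intro psd_upto_add psd_upto_scale 0 x \<open>c \<ge> 0\<close>)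
    then have "x0 + c *\<^sub>R x \<in> R" unfolding R by auto
    then have "norm (x0 + c *\<^sub>R x) \<le> K" by (rule K)
    moreover have "norm (c *\<^sub>R x) = 2 * K + 1"
      using \<open>x \<noteq> 0\<close> K0 by (simp add: c_def)
    moreover have "norm (c *\<^sub>R x) \<le> norm (x0 + c *\<^sub>R x) + norm x0"
      using norm_triangle_ineq4[of "x0 + c *\<^sub>R x" x0] by simp
    ultimately show False using K[OF \<open>x0 \<in> R\<close>] by linarith
  qed
  obtain M :: nat and m A0 A A' where A: "symmetric_upto m A0" "\<forall>i. symmetric_upto m (A i)" "\<forall>j<M. symmetric_upto m (A' j)"
    and S: "S = {x. \<exists>y. psd_upto m (pencil A0 A A' M 1 x y)}"
    using assms(1) unfolding sdp_representable_def pencil_def by auto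
  obtain N :: nat and n B0 B B' where B: "symmetric_upto n B0" "\<forall>i. symmetric_upto n (B i)" "\<forall>j<N. symmetric_upto n (B' j)"
    and T: "T = {x. \<exists>y. psd_upto n (pencil B0 B B' N 1 x y)}"
    using assms(2) unfolding sdp_representable_def pencil_def by auto
  define P where "P x l x' y z \<longleftrightarrow> l \<ge> 0 \<and> 1 - l \<ge> 0 \<and> psd_upto m (pencil A0 A A' M l x' y) \<and>
      psd_upto n (pencil B0 B B' N (1 - l) (x - x') z)"
    for x l x' y z
  let ?J = "{()} <+> (UNIV :: 'n set) <+> {..<M} <+> {..<N}"
  have "lmi ?J (\<lambda>x y. P x (y (Inl ())) (\<chi> i. y (Inr (Inl i))) (\<lambda>j. y (Inr (Inr (Inl j)))) (\<lambda>j. y (Inr (Inr (Inr j)))))"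
    unfolding P_def pencil_def
    by (intro lmi_conj lmi_nonneg lmi_psd)
      (use A B in \<open>auto intro!: affine_in_intros simp: symmetric_upto_def\<close>)
  then show ?thesis
  proof (rule sdp_representableI[rotated])
    have "(\<exists>y. P x (y (Inl ())) (\<chi> i. y (Inr (Inl i))) (\<lambda>j. y (Inr (Inr (Inl j)))) (\<lambda>j. y (Inr (Inr (Inr j)))))
      \<longleftrightarrow> (\<exists>l x' y z. P x l x' y z)" for x
    proof
      assume "\<exists>l x' y z. P x l x' y z"
      then obtain l x' y z where "P x l x' y z" by blast
      then show "\<exists>y. P x (y (Inl ())) (\<chi> i. y (Inr (Inl i))) (\<lambda>j. y (Inr (Inr (Inl j)))) (\<lambda>j. y (Inr (Inr (Inr j))))"
        by (intro exI[of _ "case_sum (\<lambda>_. l) (case_sum (($) x') (case_sum y z))"]) simp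
    qed blast
    moreover have "(\<exists>l x' y z. P x l x' y z) \<longleftrightarrow>
       (\<exists>c s t. x = c *\<^sub>R s + (1 - c) *\<^sub>R t \<and> 0 \<le> c \<and> c \<le> 1 \<and> s \<in> S \<and> t \<in> T)" for x
    proof
      assume "\<exists>c s t. x = c *\<^sub>R s + (1 - c) *\<^sub>R t \<and> 0 \<le> c \<and> c \<le> 1 \<and> s \<in> S \<and> t \<in> T"
      then obtain c s t where x: "x = c *\<^sub>R s + (1 - c) *\<^sub>R t" and c: "0 \<le> c" "c \<le> 1" and "s \<in> S" "t \<in> T"
        by blast
      then obtain y z where y: "psd_upto m (pencil A0 A A' M 1 s y)" and z: "psd_upto n (pencil B0 B B' N 1 t z)"
        using S T by blast
      have "psd_upto m (pencil A0 A A' M (c * 1) (c *\<^sub>R s) (\<lambda>j. c * y j))"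
        "psd_upto n (pencil B0 B B' N ((1 - c) * 1) ((1 - c) *\<^sub>R t) (\<lambda>j. (1 - c) * z j))"
        unfolding pencil_scale using c by (intro psd_upto_scale y z; simp)+
      then have "P x c (c *\<^sub>R s) (\<lambda>j. c * y j) (\<lambda>j. (1 - c) * z j)"
        using c by (simp add: P_def x)
      then show "\<exists>l x' y z. P x l x' y z" by blast
    next
      have rescale: "(1 / l) *\<^sub>R x \<in> {x. \<exists>y. psd_upto r (pencil F0 F G K 1 x y)}"
        if "l > 0" "psd_upto r (pencil F0 F G K l x y)" for l r F0 F G K x y
      proof -
        have "psd_upto r (pencil F0 F G K (1 / l * l) ((1 / l) *\<^sub>R x) (\<lambda>j. 1 / l * y j))"
          unfolding pencil_scale using that by (intro psd_upto_scale) auto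
        then show ?thesis using \<open>l > 0\<close> by auto
      qed
      assume "\<exists>l x' y z. P x l x' y z"
      then obtain l x' y z where l: "0 \<le> l" "l \<le> 1" and y: "psd_upto m (pencil A0 A A' M l x' y)"
        and z: "psd_upto n (pencil B0 B B' N (1 - l) (x - x') z)"
        by (auto simp: P_def)
      obtain s0 t0 where "s0 \<in> S" "t0 \<in> T" using assms by auto
      consider "l = 0" | "l = 1" | "0 < l" "l < 1" using l by linarith
      then show "\<exists>c s t. x = c *\<^sub>R s + (1 - c) *\<^sub>R t \<and> 0 \<le> c \<and> c \<le> 1 \<and> s \<in> S \<and> t \<in> T"
      proof cases
        case 1
        then have "x' = 0"
          using recession[OF assms(3,5) S] y by auto
        then have "x \<in> T" using z 1 unfolding T by auto
        then show ?thesis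
          using \<open>s0 \<in> S\<close> by (intro exI[of _ 0] exI[of _ s0] exI[of _ x]) simp
      next
        case 2
        then have "x - x' = 0"
          by (intro recession[OF assms(4,6) T]) (use z 2 in simp)
        then have "x \<in> S" using y 2 unfolding S by auto
        then show ?thesis
          using \<open>t0 \<in> T\<close> by (intro exI[of _ 1] exI[of _ x] exI[of _ t0]) simp
      next
        case 3
        have "(1 / l) *\<^sub>R x' \<in> S" "(1 / (1 - l)) *\<^sub>R (x - x') \<in> T"
          unfolding S T by (rule rescale[OF _ y] rescale[OF _ z]; use 3 in simp)+
        then show ?thesis
          using 3 by (intro exI[of _ l] exI[of _ "(1 / l) *\<^sub>R x'"] exI[of _ "(1 / (1 - l)) *\<^sub>R (x - x')"]) simp
      qed
    qed
    ultimately show "{c *\<^sub>R s + (1 - c) *\<^sub>R t | c s t. 0 \<le> c \<and> c \<le> 1 \<and> s \<in> S \<and> t \<in> T} =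
      {x. \<exists>y. P x (y (Inl ())) (\<chi> i. y (Inr (Inl i))) (\<lambda>j. y (Inr (Inr (Inl j)))) (\<lambda>j. y (Inr (Inr (Inr j))))}"
      by simp
  qed simp
qed

lemma sdp_representable_finite_cover:
  assumes "finite K" "K \<noteq> {}" "convex S" "bounded S"
    and "\<And>k. k \<in> K \<Longrightarrow> sdp_representable (T k)"
    and "\<And>k. k \<in> K \<Longrightarrow> T k \<subseteq> S" "\<And>k. k \<in> K \<Longrightarrow> T k \<noteq> {}"
    and "S \<subseteq> (\<Union>k\<in>K. T k)"
  shows "sdp_representable S"
proof -
  have "\<exists>R. sdp_representable R \<and> (\<Union>k\<in>K. T k) \<subseteq> R \<and> R \<subseteq> S"
    using assms(1,2,5-7)
  proof (induction K rule: finite_ne_induct)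
    case (singleton k)
    then show ?case by (intro exI[of _ "T k"]) auto
  next
    case (insert k K)
    then obtain R where R: "sdp_representable R" "(\<Union>k\<in>K. T k) \<subseteq> R" "R \<subseteq> S" by auto
    have "T k \<subseteq> S" "T k \<noteq> {}" "sdp_representable (T k)" using insert by auto
    have "R \<noteq> {}" using R(2) insert by fastforce
    let ?R = "{c *\<^sub>R s + (1 - c) *\<^sub>R t | c s t. 0 \<le> c \<and> c \<le> 1 \<and> s \<in> T k \<and> t \<in> R}"
    have "sdp_representable ?R"
      by (intro sdp_representable_join R \<open>R \<noteq> {}\<close> \<open>T k \<noteq> {}\<close> \<open>sdp_representable (T k)\<close>
          bounded_subset[OF \<open>bounded S\<close>] \<open>T k \<subseteq> S\<close>)
    moreover have "?R \<subseteq> S"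
      using \<open>convex S\<close> R(3) \<open>T k \<subseteq> S\<close> by (auto intro!: convexD)
    moreover have "T k \<subseteq> ?R"
    proof
      fix x assume "x \<in> T k"
      obtain t where "t \<in> R" using \<open>R \<noteq> {}\<close> by auto
      have "x = 1 *\<^sub>R x + (1 - 1) *\<^sub>R t" by simp
      with \<open>x \<in> T k\<close> \<open>t \<in> R\<close> show "x \<in> ?R"
        using zero_le_one order_refl by blast
    qed
    moreover have "R \<subseteq> ?R"
    proof
      fix x assume "x \<in> R"
      obtain t where "t \<in> T k" using \<open>T k \<noteq> {}\<close> by auto
      have "x = 0 *\<^sub>R t + (1 - 0) *\<^sub>R x" by simp
      with \<open>x \<in> R\<close> \<open>t \<in> T k\<close> show "x \<in> ?R"
        using zero_le_one order_refl by blast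
    qed
    ultimately show ?case
      using R(2) by (intro exI[of _ ?R] conjI) auto
  qed
  then show ?thesis using assms(8) by (metis order_trans subset_antisym)
qed

section \<open>Lifting to signed measures of finite support\<close>

lemma finite_interpolation_points:
  fixes F :: "('x \<Rightarrow> real) set"
  assumes "finite F"
  shows "\<exists>P. finite P \<and> (\<forall>x. \<exists>y. \<forall>f\<in>F. (\<Sum>t\<in>P. y t * f t) = f x)"
  using assms
proof (induction F rule: finite_induct)
  case empty
  show ?case by (intro exI[of _ "{}"]) simp
next
  case (insert g F)
  obtain P where "finite P" and P: "\<forall>x. \<exists>y. \<forall>f\<in>F. (\<Sum>t\<in>P. y t * f t) = f x"
    using insert.IH by (elim exE conjE)
  obtain Y where Y': "\<forall>x. \<forall>f\<in>F. (\<Sum>t\<in>P. Y x t * f t) = f x"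
    using choice[OF P] by (elim exE)
  have Y: "(\<Sum>t\<in>P. Y x t * f t) = f x" if "f \<in> F" for x f
    using Y'[THEN spec[of _ x], THEN bspec, OF that] .
  define h where "h x = g x - (\<Sum>t\<in>P. Y x t * g t)" for x
  show ?case
  proof (cases "\<forall>x. h x = 0")
    case True
    have "(\<Sum>t\<in>P. Y x t * g t) = g x" for x
      using True[THEN spec, of x] unfolding h_def by linarith
    then have "\<forall>f\<in>insert g F. (\<Sum>t\<in>P. Y x t * f t) = f x" for x
      using Y by simp
    then show ?thesis using \<open>finite P\<close> by (intro exI[of _ P] conjI allI exI[of _ "Y _"])
  next
    case False
    then obtain q where q: "h q \<noteq> 0" by blast
    define Z where "Z x t = (if t \<in> P then Y x t - h x / h q * Y q t else 0) + (if t = q then h x / h q else 0)" for x t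
    have Z: "(\<Sum>t\<in>insert q P. Z x t * f t) =
        (\<Sum>t\<in>P. Y x t * f t) + h x / h q * (f q - (\<Sum>t\<in>P. Y q t * f t))" for x f
    proof -
      have "(\<Sum>t\<in>insert q P. Z x t * f t) = (\<Sum>t\<in>insert q P. if t \<in> P then (Y x t - h x / h q * Y q t) * f t else 0)
          + (\<Sum>t\<in>insert q P. if t = q then h x / h q * f t else 0)"
        unfolding sum.distrib[symmetric] by (intro sum.cong) (auto simp: Z_def ring_distribs)
      also have "(\<Sum>t\<in>insert q P. if t = q then h x / h q * f t else 0) = h x / h q * f q"
        using \<open>finite P\<close> by (subst sum.delta) auto
      also have "(\<Sum>t\<in>insert q P. if t \<in> P then (Y x t - h x / h q * Y q t) * f t else 0) =
          (\<Sum>t\<in>P. (Y x t - h x / h q * Y q t) * f t)"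
        using \<open>finite P\<close> by (intro sum.mono_neutral_cong_right) auto
      finally show ?thesis
        by (simp add: left_diff_distrib right_diff_distrib sum_subtractf sum_distrib_left mult.assoc del: times_divide_eq_left)
    qed
    have "(\<Sum>t\<in>insert q P. Z x t * f t) = f x" if "f \<in> insert g F" for f x
    proof (cases "f = g")
      case True
      then show ?thesis unfolding Z using q by (simp add: h_def[symmetric]) (simp add: h_def)
    next
      case False
      then have "f \<in> F" using that by simp
      then show ?thesis unfolding Z by (simp add: Y)
    qed
    then have "\<forall>f\<in>insert g F. (\<Sum>t\<in>insert q P. Z x t * f t) = f x" for x by (rule ballI)
    then show ?thesis
      using \<open>finite P\<close> by (intro exI[of _ "insert q P"] conjI allI exI[of _ "Z _"] finite.insertI)
  qed
qed

definition lincomb :: "('x \<Rightarrow> real) set \<Rightarrow> ('x \<Rightarrow> real) set" where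
  "lincomb F = {\<lambda>x. \<Sum>f\<in>F. v f * f x | v. True}"

lemma lincombI: "h = (\<lambda>x. \<Sum>f\<in>F. v f * f x) \<Longrightarrow> h \<in> lincomb F"
  unfolding lincomb_def by (intro CollectI exI[of _ v] conjI TrueI)

lemma lincomb_add: "f \<in> lincomb F \<Longrightarrow> g \<in> lincomb F \<Longrightarrow> (\<lambda>x. f x + g x) \<in> lincomb F"
proof -
  assume "f \<in> lincomb F" "g \<in> lincomb F"
  then obtain v w where "f = (\<lambda>x. \<Sum>f\<in>F. v f * f x)" "g = (\<lambda>x. \<Sum>f\<in>F. w f * f x)"
    by (auto simp: lincomb_def)
  then have "(\<lambda>x. f x + g x) = (\<lambda>x. \<Sum>f\<in>F. (v f + w f) * f x)"
    by (simp add: ring_distribs sum.distrib)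
  then show ?thesis by (rule lincombI)
qed

lemma lincomb_cmult: "f \<in> lincomb F \<Longrightarrow> (\<lambda>x. c * f x) \<in> lincomb F"
proof -
  assume "f \<in> lincomb F"
  then obtain v where "f = (\<lambda>x. \<Sum>f\<in>F. v f * f x)" by (auto simp: lincomb_def)
  then have "(\<lambda>x. c * f x) = (\<lambda>x. \<Sum>f\<in>F. (c * v f) * f x)"
    by (simp add: sum_distrib_left mult.assoc)
  then show ?thesis by (rule lincombI)
qed

lemma lincomb_zero: "(\<lambda>x. 0) \<in> lincomb F"
  unfolding lincomb_def by (auto intro!: exI[of _ "\<lambda>_. 0"])

lemma lincomb_base:
  assumes "finite F" "f \<in> F"
  shows "f \<in> lincomb F"
proof -
  have "f = (\<lambda>x. \<Sum>g\<in>F. (if g = f then 1 else 0) * g x)"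
    using assms by (simp add: if_distrib[of "\<lambda>c. c * _"] sum.delta' cong: if_cong)
  then show ?thesis by (rule lincombI)
qed

lemma lincomb_sum: "(\<And>k. k \<in> K \<Longrightarrow> f k \<in> lincomb F) \<Longrightarrow> (\<lambda>x. \<Sum>k\<in>K. f k x) \<in> lincomb F"
  by (induction K rule: infinite_finite_induct) (simp_all add: lincomb_zero lincomb_add)

lemma lincomb_diff: "f \<in> lincomb F \<Longrightarrow> g \<in> lincomb F \<Longrightarrow> (\<lambda>x. f x - g x) \<in> lincomb F"
  using lincomb_add[of f F "\<lambda>x. -1 * g x"] lincomb_cmult[of g F "-1"] by simp

definition conecomb :: "('x \<Rightarrow> real) set \<Rightarrow> ('x \<Rightarrow> real) set" where
  "conecomb F = {\<lambda>x. \<Sum>f\<in>F. v f * f x | v. \<forall>f. v f \<ge> 0}"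

lemma conecombI:
  assumes "h = (\<lambda>x. \<Sum>f\<in>F. v f * f x)" "\<forall>f. v f \<ge> 0"
  shows "h \<in> conecomb F"
  unfolding conecomb_def by (intro CollectI exI[of _ v] conjI assms)

lemma conecomb_add: "f \<in> conecomb F \<Longrightarrow> g \<in> conecomb F \<Longrightarrow> (\<lambda>x. f x + g x) \<in> conecomb F"
proof -
  assume "f \<in> conecomb F" "g \<in> conecomb F"
  then obtain v w where "f = (\<lambda>x. \<Sum>f\<in>F. v f * f x)" "g = (\<lambda>x. \<Sum>f\<in>F. w f * f x)"
    and nn: "\<forall>f. v f \<ge> 0" "\<forall>f. w f \<ge> 0"
    by (auto simp: conecomb_def)
  then have "(\<lambda>x. f x + g x) = (\<lambda>x. \<Sum>f\<in>F. (v f + w f) * f x)"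
    by (simp add: ring_distribs sum.distrib)
  moreover have "\<forall>f. v f + w f \<ge> 0" using nn by simp
  ultimately show ?thesis by (rule conecombI)
qed

lemma conecomb_cmult: "f \<in> conecomb F \<Longrightarrow> c \<ge> 0 \<Longrightarrow> (\<lambda>x. c * f x) \<in> conecomb F"
proof -
  assume "f \<in> conecomb F" "c \<ge> 0"
  then obtain v where "f = (\<lambda>x. \<Sum>f\<in>F. v f * f x)" and nn: "\<forall>f. v f \<ge> 0"
    by (auto simp: conecomb_def)
  then have "(\<lambda>x. c * f x) = (\<lambda>x. \<Sum>f\<in>F. (c * v f) * f x)"
    by (simp add: sum_distrib_left mult.assoc)
  moreover have "\<forall>f. c * v f \<ge> 0" using nn \<open>c \<ge> 0\<close> by simp
  ultimately show ?thesis by (rule conecombI)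
qed

lemma conecomb_zero: "(\<lambda>x. 0) \<in> conecomb F"
  unfolding conecomb_def by (auto intro!: exI[of _ "\<lambda>_. 0"])

lemma conecomb_base:
  assumes "finite F" "f \<in> F"
  shows "f \<in> conecomb F"
proof -
  have "f = (\<lambda>x. \<Sum>g\<in>F. (if g = f then 1 else 0) * g x)"
    using assms by (simp add: if_distrib[of "\<lambda>c. c * _"] sum.delta' cong: if_cong)
  moreover have "\<forall>g. (if g = f then 1 else 0 :: real) \<ge> 0" by simp
  ultimately show ?thesis by (rule conecombI)
qed

lemma conecomb_sum: "(\<And>k. k \<in> K \<Longrightarrow> f k \<in> conecomb F) \<Longrightarrow> (\<lambda>x. \<Sum>k\<in>K. f k x) \<in> conecomb F"
  by (induction K rule: infinite_finite_induct) (simp_all add: conecomb_zero conecomb_add)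

lemma conecomb_mono:
  assumes "finite F" "E \<subseteq> F"
  shows "conecomb E \<subseteq> conecomb F"
proof
  fix h assume "h \<in> conecomb E"
  then obtain v where h: "h = (\<lambda>x. \<Sum>f\<in>E. v f * f x)" and "\<forall>f. v f \<ge> 0"
    by (auto simp: conecomb_def)
  then show "h \<in> conecomb F"
    unfolding h using assms by (intro conecomb_sum conecomb_cmult conecomb_base) auto
qed

lemma sdp_representable_lift:
  fixes B :: "(real ^ 'n) set" and G :: "real ^ 'n \<Rightarrow> real"
    and \<Theta> :: "((real ^ 'n \<Rightarrow> real) \<times> (real ^ 'n \<Rightarrow> real) set) set"
  assumes "finite \<Theta>" and fin: "\<And>w \<Phi>. (w, \<Phi>) \<in> \<Theta> \<Longrightarrow> finite \<Phi>"
    and B: "sdp_representable B"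
    and w: "\<And>w \<Phi> x. (w, \<Phi>) \<in> \<Theta> \<Longrightarrow> x \<in> B \<Longrightarrow> w x \<ge> 0"
    and jensen: "\<And>u P y. u \<in> B \<Longrightarrow> finite P \<Longrightarrow> (\<Sum>t\<in>P. y t) = 1 \<Longrightarrow> (\<Sum>t\<in>P. y t *\<^sub>R t) = u \<Longrightarrow>
      (\<And>w \<Phi> \<psi>. (w, \<Phi>) \<in> \<Theta> \<Longrightarrow> \<psi> \<in> lincomb \<Phi> \<Longrightarrow> (\<Sum>t\<in>P. y t * (w t * (\<psi> t)\<^sup>2)) \<ge> 0) \<Longrightarrow>
      (\<Sum>t\<in>P. y t * G t) \<le> G u"
  shows "sdp_representable (B \<inter> {x. G x \<ge> 0})"
proof -
  define F where "F = {\<lambda>x. 1, G} \<union> range (\<lambda>i x. x $ i) \<union>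
    (\<Union>\<theta>\<in>\<Theta>. (\<lambda>(f, g) x. fst \<theta> x * f x * g x) ` (snd \<theta> \<times> snd \<theta>))"
  have "finite F"
    using \<open>finite \<Theta>\<close> fin unfolding F_def by auto
  then obtain P :: "(real ^ 'n) set" where "finite P"
    and P: "\<And>x. \<exists>y. \<forall>f\<in>F. (\<Sum>t\<in>P. y t * f t) = f x"
    using finite_interpolation_points by blast
  have "\<exists>e. bij_betw e {..<card (snd \<theta>)} (snd \<theta>)" if "\<theta> \<in> \<Theta>" for \<theta>
    using ex_bij_betw_nat_finite[OF fin[of "fst \<theta>" "snd \<theta>"]] that by (simp add: lessThan_atLeast0)
  then obtain e where e: "\<And>\<theta>. \<theta> \<in> \<Theta> \<Longrightarrow> bij_betw (e \<theta>) {..<card (snd \<theta>)} (snd \<theta>)"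
    by metis
  define Q where "Q x y \<longleftrightarrow> (\<Sum>t\<in>P. y t) = 1 \<and> (\<forall>i\<in>UNIV. (\<Sum>t\<in>P. y t * t $ i) = x $ i) \<and>
      (\<Sum>t\<in>P. y t * G t) \<ge> 0 \<and>
      (\<forall>\<theta>\<in>\<Theta>. psd_upto (card (snd \<theta>)) (\<lambda>a b. \<Sum>t\<in>P. y t * (fst \<theta> t * e \<theta> a t * e \<theta> b t)))"
    for x :: "real ^ 'n" and y :: "real ^ 'n \<Rightarrow> real"
  have form: "(\<Sum>a<r. \<Sum>b<r. v a * (\<Sum>t\<in>P. y t * (w t * f a t * f b t)) * v b) =
      (\<Sum>t\<in>P. y t * (w t * (\<Sum>a<r. v a * f a t)\<^sup>2))"
    for y w :: "real ^ 'n \<Rightarrow> real" and f :: "nat \<Rightarrow> real ^ 'n \<Rightarrow> real" and v :: "nat \<Rightarrow> real" and r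
  proof -
    have "(\<Sum>a<r. \<Sum>b<r. v a * (\<Sum>t\<in>P. y t * (w t * f a t * f b t)) * v b) =
        (\<Sum>a<r. \<Sum>b<r. \<Sum>t\<in>P. y t * (w t * ((v a * f a t) * (v b * f b t))))"
      by (intro sum.cong refl) (simp add: sum_distrib_left sum_distrib_right mult_ac)
    also have "\<dots> = (\<Sum>t\<in>P. \<Sum>a<r. \<Sum>b<r. y t * (w t * ((v a * f a t) * (v b * f b t))))"
      by (simp only: sum.swap[of _ P "{..<r}"])
    also have "\<dots> = (\<Sum>t\<in>P. y t * (w t * (\<Sum>a<r. v a * f a t)\<^sup>2))"
      by (simp only: power2_eq_square sum_product) (simp only: sum_distrib_left)
    finally show ?thesis .
  qed
  have aff: "affine_in P (\<lambda>(x :: real ^ 'n) y. \<Sum>t\<in>P. y t * f t)" for f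
    by (intro affine_in_sum affine_in_mult_right affine_in_var \<open>finite P\<close>)
  have "lmi P Q"
    unfolding Q_def
    by (intro lmi_conj lmi_eq lmi_ball lmi_nonneg lmi_psd aff aff[of "\<lambda>_. 1", simplified]
        affine_in_const affine_in_coord \<open>finite \<Theta>\<close> finite ext)
      (simp_all add: mult_ac)
  then have R: "sdp_representable {x. \<exists>y. Q x y}"
    by (rule sdp_representableI[OF \<open>finite P\<close>]) simp
  have "B \<inter> {x. G x \<ge> 0} = B \<inter> {x. \<exists>y. Q x y}"
  proof (intro equalityI subsetI)
    fix x assume "x \<in> B \<inter> {x. G x \<ge> 0}"
    then have "x \<in> B" "G x \<ge> 0" by auto
    obtain y where y': "\<forall>f\<in>F. (\<Sum>t\<in>P. y t * f t) = f x" using P[of x] by blast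
    have y: "(\<Sum>t\<in>P. y t * f t) = f x" if "f \<in> F" for f
      using y' that by simp
    have "(\<Sum>t\<in>P. y t * 1) = 1" "(\<Sum>t\<in>P. y t * G t) = G x"
      by (intro y; simp add: F_def)+
    moreover have "(\<Sum>t\<in>P. y t * t $ i) = x $ i" for i
      by (rule y) (simp add: F_def)
    moreover have "psd_upto (card (snd \<theta>)) (\<lambda>a b. \<Sum>t\<in>P. y t * (fst \<theta> t * e \<theta> a t * e \<theta> b t))"
      if "\<theta> \<in> \<Theta>" for \<theta>
    proof -
      have L: "(\<Sum>t\<in>P. y t * (fst \<theta> t * e \<theta> a t * e \<theta> b t)) = fst \<theta> x * e \<theta> a x * e \<theta> b x"
        if "a < card (snd \<theta>)" "b < card (snd \<theta>)" for a b
      proof (rule y)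
        have "e \<theta> a \<in> snd \<theta>" "e \<theta> b \<in> snd \<theta>"
          using e[OF \<open>\<theta> \<in> \<Theta>\<close>] that by (auto simp: bij_betw_def)
        then show "(\<lambda>t. fst \<theta> t * e \<theta> a t * e \<theta> b t) \<in> F"
          unfolding F_def using \<open>\<theta> \<in> \<Theta>\<close> by (intro UnI2 UN_I[of \<theta>] image_eqI[of _ _ "(e \<theta> a, e \<theta> b)"]) auto
      qed
      have "(\<Sum>a<card (snd \<theta>). \<Sum>b<card (snd \<theta>). v a * (\<Sum>t\<in>P. y t * (fst \<theta> t * e \<theta> a t * e \<theta> b t)) * v b) \<ge> 0"
        for v :: "nat \<Rightarrow> real"
      proof -
        have "(\<Sum>a<card (snd \<theta>). \<Sum>b<card (snd \<theta>). v a * (\<Sum>t\<in>P. y t * (fst \<theta> t * e \<theta> a t * e \<theta> b t)) * v b) =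
            (\<Sum>a<card (snd \<theta>). \<Sum>b<card (snd \<theta>). fst \<theta> x * ((v a * e \<theta> a x) * (v b * e \<theta> b x)))"
          by (intro sum.cong refl) (subst L; simp add: mult_ac)
        also have "\<dots> = fst \<theta> x * (\<Sum>a<card (snd \<theta>). v a * e \<theta> a x)\<^sup>2"
          by (simp only: power2_eq_square sum_product) (simp only: sum_distrib_left)
        finally show ?thesis
          using w[of "fst \<theta>" "snd \<theta>" x] \<open>\<theta> \<in> \<Theta>\<close> \<open>x \<in> B\<close> by simp
      qed
      then show ?thesis
        by (simp only: psd_upto_def symmetric_upto_def) (simp add: mult_ac)
    qed
    ultimately have "Q x y"
      using \<open>G x \<ge> 0\<close> by (simp add: Q_def)
    then show "x \<in> B \<inter> {x. \<exists>y. Q x y}" using \<open>x \<in> B\<close> by blast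
  next
    fix u assume "u \<in> B \<inter> {x. \<exists>y. Q x y}"
    then obtain y where "u \<in> B" and Q: "Q u y" by blast
    have "(\<Sum>t\<in>P. y t * G t) \<le> G u"
    proof (rule jensen[OF \<open>u \<in> B\<close> \<open>finite P\<close>])
      show "(\<Sum>t\<in>P. y t) = 1" using Q by (simp add: Q_def)
      show "(\<Sum>t\<in>P. y t *\<^sub>R t) = u"
        using Q by (simp add: Q_def vec_eq_iff)
      fix w \<Phi> \<psi> assume \<theta>: "(w, \<Phi>) \<in> \<Theta>" and "\<psi> \<in> lincomb \<Phi>"
      then obtain v where v: "\<psi> = (\<lambda>x. \<Sum>f\<in>\<Phi>. v f * f x)" by (auto simp: lincomb_def)
      have \<psi>: "\<psi> x = (\<Sum>a<card \<Phi>. v (e (w, \<Phi>) a) * e (w, \<Phi>) a x)" for x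
        unfolding v using sum.reindex_bij_betw[OF e[OF \<theta>], of "\<lambda>f. v f * f x"] by simp
      have "psd_upto (card \<Phi>) (\<lambda>a b. \<Sum>t\<in>P. y t * (w t * e (w, \<Phi>) a t * e (w, \<Phi>) b t))"
        using Q[unfolded Q_def, THEN conjunct2, THEN conjunct2, THEN conjunct2, THEN bspec[OF _ \<theta>]] by simp
      then show "(\<Sum>t\<in>P. y t * (w t * (\<psi> t)\<^sup>2)) \<ge> 0"
        unfolding \<psi> form[symmetric] by (simp add: psd_upto_def)
    qed
    then show "u \<in> B \<inter> {x. G x \<ge> 0}" using Q \<open>u \<in> B\<close> by (simp add: Q_def)
  qed
  then show ?thesis using sdp_representable_Int[OF B R] by simp
qed

section \<open>Jensen's inequality along segments\<close>

lemma has_derivative_partial_deriv_eq: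
  fixes f :: "real ^ 'n \<Rightarrow> real"
  assumes "(f has_derivative f') (at x)"
  shows "((\<lambda>t. f (x + t *\<^sub>R axis i 1)) has_real_derivative f' (axis i 1)) (at 0)"
    and "partial_deriv i f x = f' (axis i 1)"
proof -
  have "((\<lambda>t. f (x + t *\<^sub>R axis i 1)) has_derivative (\<lambda>t. f' (t *\<^sub>R axis i 1))) (at 0)"
    by (rule has_derivative_compose[of "\<lambda>t. x + t *\<^sub>R axis i 1" _ 0 UNIV f])
      (use assms in \<open>auto intro!: derivative_eq_intros\<close>)
  moreover have "f' (t *\<^sub>R axis i 1) = t * f' (axis i 1)" for t
    using linear_scale[OF has_derivative_linear[OF assms]] by simp
  ultimately show D: "((\<lambda>t. f (x + t *\<^sub>R axis i 1)) has_real_derivative f' (axis i 1)) (at 0)"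
    by (simp add: has_field_derivative_def mult.commute[of _ "f' (axis i 1)"])
  then show "partial_deriv i f x = f' (axis i 1)"
    unfolding partial_deriv_def by (rule DERIV_imp_deriv)
qed

lemma real_polynomial_derivative:
  fixes f :: "real ^ 'n \<Rightarrow> real"
  assumes "real_polynomial_function f"
  shows "\<exists>f'. (\<forall>v. real_polynomial_function (\<lambda>x. f' x v)) \<and> (\<forall>x. (f has_derivative f' x) (at x))"
  using assms
proof (induction f rule: real_polynomial_function.induct)
  case (linear f)
  then show ?case
    by (intro exI[of _ "\<lambda>x. f"]) (auto intro: bounded_linear_imp_has_derivative)
next
  case (const c)
  show ?case by (intro exI[of _ "\<lambda>x v. 0"]) auto
next
  case (add f g)
  then obtain f' g' where "\<forall>v. real_polynomial_function (\<lambda>x. f' x v)" "\<forall>x. (f has_derivative f' x) (at x)"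
    "\<forall>v. real_polynomial_function (\<lambda>x. g' x v)" "\<forall>x. (g has_derivative g' x) (at x)"
    by blast
  then show ?case
    by (intro exI[of _ "\<lambda>x v. f' x v + g' x v"]) (auto intro!: has_derivative_add)
next
  case (mult f g)
  then obtain f' g' where "\<forall>v. real_polynomial_function (\<lambda>x. f' x v)" "\<forall>x. (f has_derivative f' x) (at x)"
    "\<forall>v. real_polynomial_function (\<lambda>x. g' x v)" "\<forall>x. (g has_derivative g' x) (at x)"
    by blast
  then show ?case
    using mult.hyps
    by (intro exI[of _ "\<lambda>x v. f x * g' x v + f' x v * g x"])
      (auto intro!: has_derivative_mult real_polynomial_function.intros(3,4))
qed

lemma vec_eq_sum_axis: "v = (\<Sum>i\<in>UNIV. v $ i *\<^sub>R axis i (1::real))"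
  by (simp add: vec_eq_iff axis_def if_distrib[of "\<lambda>c. _ * c"] cong: if_cong)

lemma
  fixes f :: "real ^ 'n \<Rightarrow> real"
  assumes "real_polynomial_function f"
  shows real_polynomial_partial_deriv: "real_polynomial_function (partial_deriv i f)"
    and real_polynomial_has_derivative: "(f has_derivative (\<lambda>v. \<Sum>i\<in>UNIV. v $ i * partial_deriv i f x)) (at x)"
    and real_polynomial_has_partial_deriv:
      "((\<lambda>t. f (x + t *\<^sub>R axis i 1)) has_real_derivative partial_deriv i f x) (at 0)"
proof -
  obtain f' where f': "\<And>v. real_polynomial_function (\<lambda>x. f' x v)" "\<And>x. (f has_derivative f' x) (at x)"
    using real_polynomial_derivative[OF assms] by blast
  have eq: "partial_deriv i f x = f' x (axis i 1)" for x i
    by (rule has_derivative_partial_deriv_eq(2)[OF f'(2)])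
  then show "real_polynomial_function (partial_deriv i f)"
    using f'(1)[of "axis i 1"] by (simp add: eq[abs_def])
  show "((\<lambda>t. f (x + t *\<^sub>R axis i 1)) has_real_derivative partial_deriv i f x) (at 0)"
    unfolding eq by (rule has_derivative_partial_deriv_eq(1)[OF f'(2)])
  have "f' x v = (\<Sum>i\<in>UNIV. v $ i * partial_deriv i f x)" for v
  proof -
    have lin: "linear (f' x)" by (rule has_derivative_linear[OF f'(2)])
    have "f' x v = f' x (\<Sum>i\<in>UNIV. v $ i *\<^sub>R axis i 1)" by (subst vec_eq_sum_axis) simp
    then show ?thesis
      by (simp add: linear_sum[OF lin] linear_scale[OF lin] eq)
  qed
  then have "f' x = (\<lambda>v. \<Sum>i\<in>UNIV. v $ i * partial_deriv i f x)" by (rule ext)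
  then show "(f has_derivative (\<lambda>v. \<Sum>i\<in>UNIV. v $ i * partial_deriv i f x)) (at x)"
    using f'(2)[of x] by simp
qed

lemma real_polynomial_hessian:
  "real_polynomial_function f \<Longrightarrow> real_polynomial_function (\<lambda>x. hessian f x $ i $ j)"
  unfolding hessian_def by (simp add: real_polynomial_partial_deriv)

lemma quadratic_form_eq: "v \<bullet> (A *v v) = (\<Sum>i\<in>UNIV. \<Sum>j\<in>UNIV. v $ i * v $ j * A $ i $ j)"
  by (simp add: inner_vec_def matrix_vector_mult_def sum_distrib_left mult_ac)

lemma real_polynomial_line_deriv:
  fixes f :: "real ^ 'n \<Rightarrow> real"
  assumes "real_polynomial_function f"
  shows "((\<lambda>s. f (u + s *\<^sub>R v)) has_real_derivative (\<Sum>i\<in>UNIV. v $ i * partial_deriv i f (u + s *\<^sub>R v))) (at s)"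
proof -
  have "((\<lambda>s. f (u + s *\<^sub>R v)) has_derivative
      (\<lambda>t. \<Sum>i\<in>UNIV. (t *\<^sub>R v) $ i * partial_deriv i f (u + s *\<^sub>R v))) (at s)"
    by (rule has_derivative_compose[of "\<lambda>s. u + s *\<^sub>R v" _ s UNIV f, OF _ real_polynomial_has_derivative[OF assms]])
      (auto intro!: derivative_eq_intros)
  moreover have "(\<lambda>t. \<Sum>i\<in>UNIV. (t *\<^sub>R v) $ i * partial_deriv i f (u + s *\<^sub>R v)) =
      (*) (\<Sum>i\<in>UNIV. v $ i * partial_deriv i f (u + s *\<^sub>R v))"
    by (rule ext) (simp add: sum_distrib_left mult_ac)
  ultimately show ?thesis
    by (simp add: has_field_derivative_def)
qed

lemma jensen_functional:
  fixes G :: "real ^ 'n \<Rightarrow> real" and y :: "real ^ 'n \<Rightarrow> real"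
  assumes G: "real_polynomial_function G"
    and mass: "(\<Sum>t\<in>P. y t) = 1" and bary: "(\<Sum>t\<in>P. y t *\<^sub>R t) = u"
    and neg: "\<And>s. 0 \<le> s \<Longrightarrow> s \<le> 1 \<Longrightarrow>
      (\<Sum>t\<in>P. y t * ((t - u) \<bullet> (hessian G (u + s *\<^sub>R (t - u)) *v (t - u)))) \<le> 0"
  shows "(\<Sum>t\<in>P. y t * G t) \<le> G u"
proof -
  define h where "h s = (\<Sum>t\<in>P. y t * G (u + s *\<^sub>R (t - u)))" for s
  define h' where "h' s = (\<Sum>t\<in>P. y t * (\<Sum>j\<in>UNIV. (t - u) $ j * partial_deriv j G (u + s *\<^sub>R (t - u))))" for s
  define h'' where "h'' s = (\<Sum>t\<in>P. y t * (\<Sum>j\<in>UNIV. (t - u) $ j *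
      (\<Sum>i\<in>UNIV. (t - u) $ i * partial_deriv i (partial_deriv j G) (u + s *\<^sub>R (t - u)))))" for s
  have h: "(h has_real_derivative h' s) (at s)" for s
    unfolding h_def h'_def by (intro DERIV_sum DERIV_cmult real_polynomial_line_deriv G)
  have h': "(h' has_real_derivative h'' s) (at s)" for s
    unfolding h'_def h''_def
    by (intro DERIV_sum DERIV_cmult real_polynomial_line_deriv real_polynomial_partial_deriv G)
  have "h'' s = (\<Sum>t\<in>P. y t * ((t - u) \<bullet> (hessian G (u + s *\<^sub>R (t - u)) *v (t - u))))" for s
  proof -
    have "(\<Sum>j\<in>UNIV. v $ j * (\<Sum>i\<in>UNIV. v $ i * partial_deriv i (partial_deriv j G) x)) = v \<bullet> (hessian G x *v v)"
      for v x
      unfolding quadratic_form_eq hessian_def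
      by (subst sum.swap) (simp add: sum_distrib_left mult_ac)
    then show ?thesis unfolding h''_def by (simp only:)
  qed
  then have h'': "h'' s \<le> 0" if "0 \<le> s" "s \<le> 1" for s
    using neg that by simp
  have zero: "(\<Sum>t\<in>P. y t * (t - u) $ j) = 0" for j
  proof -
    have "(\<Sum>t\<in>P. y t * (t - u) $ j) = (\<Sum>t\<in>P. y t *\<^sub>R t) $ j - (\<Sum>t\<in>P. y t) * u $ j"
      by (simp add: right_diff_distrib sum_subtractf sum_distrib_right)
    then show ?thesis by (simp add: mass bary)
  qed
  have "h' 0 = (\<Sum>j\<in>UNIV. (\<Sum>t\<in>P. y t * (t - u) $ j) * partial_deriv j G u)"
    unfolding h'_def by (simp add: sum_distrib_left sum_distrib_right mult_ac sum.swap[of _ P])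
  then have "h' 0 = 0" by (simp only: zero) simp
  have "h' s \<le> 0" if "0 \<le> s" "s \<le> 1" for s
  proof -
    have "h' s \<le> h' 0"
      by (rule DERIV_nonpos_imp_nonincreasing[OF that(1)]) (use h' h'' that in \<open>meson order_trans\<close>)
    then show ?thesis using \<open>h' 0 = 0\<close> by simp
  qed
  then have "h 1 \<le> h 0"
    by (intro DERIV_nonpos_imp_nonincreasing[of 0 1]) (use h in \<open>auto\<close>)
  then show ?thesis
    by (simp add: h_def sum_distrib_right[symmetric] mass)
qed

definition separates_segments ::
    "nat set \<Rightarrow> (nat \<Rightarrow> 'a \<Rightarrow> real \<Rightarrow> real) \<Rightarrow> (nat \<Rightarrow> 'a \<Rightarrow> real) \<Rightarrow> ('a::real_normed_vector \<Rightarrow> real) \<Rightarrow> bool" where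
  "separates_segments I c f E \<longleftrightarrow> finite I \<and> (\<forall>k\<in>I. continuous_on UNIV (\<lambda>(u, s). c k u s)) \<and>
    (\<forall>k\<in>I. continuous_on UNIV (f k)) \<and>
    (\<forall>u s x. E (u + s *\<^sub>R (x - u)) = (\<Sum>k\<in>I. c k u s * f k x))"

lemma separates_segmentsI:
  fixes I :: "nat set"
  assumes "finite I" "\<And>k. k \<in> I \<Longrightarrow> continuous_on UNIV (\<lambda>(u, s). c k u s)"
    and "\<And>k. k \<in> I \<Longrightarrow> continuous_on UNIV (f k)"
    and "\<And>u s x. E (u + s *\<^sub>R (x - u)) = (\<Sum>k\<in>I. c k u s * f k x)"
  shows "\<exists>I c f. separates_segments I c f E"
  using assms by (intro exI[of _ I] exI[of _ c] exI[of _ f]) (simp add: separates_segments_def)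

lemma separates_segmentsD:
  assumes "separates_segments I c f E"
  shows "finite I" "k \<in> I \<Longrightarrow> continuous_on UNIV (\<lambda>(u, s). c k u s)"
    "k \<in> I \<Longrightarrow> continuous_on UNIV (f k)" "E (u + s *\<^sub>R (x - u)) = (\<Sum>k\<in>I. c k u s * f k x)"
  using assms by (auto simp: separates_segments_def)

lemma real_polynomial_segment_separation:
  fixes E :: "'a::real_normed_vector \<Rightarrow> real"
  assumes "real_polynomial_function E"
  shows "\<exists>I c f. separates_segments I c f E"
  using assms
proof (induction E rule: real_polynomial_function.induct)
  case (linear E)
  define c where "c k u s = (if k = 0 then (1 - s) * E u else s)" for k :: nat and u s
  define f where "f k x = (if k = 0 then 1 else E x)" for k :: nat and x
  have "continuous_on UNIV (\<lambda>(u, s). c k u s)" "continuous_on UNIV (f k)" for k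
    unfolding c_def f_def split_def
    by (cases "k = 0"; auto intro!: continuous_intros bounded_linear.continuous_on[OF linear])+
  moreover have "E (u + s *\<^sub>R (x - u)) = (\<Sum>k\<in>{0, 1}. c k u s * f k x)" for u s x
  proof -
    have lin: "linear E" by (rule bounded_linear.linear[OF linear])
    show ?thesis
      by (simp add: c_def f_def linear_add[OF lin] linear_diff[OF lin] linear_scale[OF lin] algebra_simps)
  qed
  ultimately show ?case
    by (intro separates_segmentsI[of "{0, 1}" c f]) simp_all
next
  case (const a)
  show ?case
    by (rule separates_segmentsI[of "{0}" "\<lambda>_ _ _. a" "\<lambda>_ _. 1"]) auto
next
  case (add E F)
  obtain I c f where "separates_segments I c f E"
    using add.IH(1) by blast
  note E = separates_segmentsD[OF this]
  obtain J d g where "separates_segments J d g F"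
    using add.IH(2) by blast
  note F = separates_segmentsD[OF this]
  define K where "K = sum_encode ` (I <+> J)"
  define c' where "c' k = (case sum_decode k of Inl i \<Rightarrow> c i | Inr j \<Rightarrow> d j)" for k
  define f' where "f' k = (case sum_decode k of Inl i \<Rightarrow> f i | Inr j \<Rightarrow> g j)" for k
  have "(\<Sum>k\<in>K. c' k u s * f' k x) = E (u + s *\<^sub>R (x - u)) + F (u + s *\<^sub>R (x - u))" for u s x
    unfolding K_def E(4) F(4)
    by (subst sum.reindex) (auto simp: inj_sum_encode sum.Plus E(1) F(1) c'_def f'_def)
  moreover have "continuous_on UNIV (\<lambda>(u, s). c' k u s)" "continuous_on UNIV (f' k)" if "k \<in> K" for k
    using that E F unfolding K_def by (auto simp: c'_def f'_def)
  moreover have "finite K" using E F by (simp add: K_def)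
  ultimately show ?case
    by (intro separates_segmentsI[of K c' f']) simp_all
next
  case (mult E F)
  obtain I c f where "separates_segments I c f E"
    using mult.IH(1) by blast
  note E = separates_segmentsD[OF this]
  obtain J d g where "separates_segments J d g F"
    using mult.IH(2) by blast
  note F = separates_segmentsD[OF this]
  define K where "K = prod_encode ` (I \<times> J)"
  define c' where "c' k u s = c (fst (prod_decode k)) u s * d (snd (prod_decode k)) u s" for k u s
  define f' where "f' k x = f (fst (prod_decode k)) x * g (snd (prod_decode k)) x" for k x
  have "(\<Sum>k\<in>K. c' k u s * f' k x) = E (u + s *\<^sub>R (x - u)) * F (u + s *\<^sub>R (x - u))" for u s x
    unfolding K_def E(4) F(4)
    by (subst sum.reindex)
      (auto simp: inj_prod_encode sum_product sum.cartesian_product c'_def f'_def split_def mult_ac)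
  moreover have "continuous_on UNIV (\<lambda>(u, s). c' k u s)" "continuous_on UNIV (f' k)" if "k \<in> K" for k
    using that E F unfolding K_def
    by (auto simp: c'_def[abs_def] f'_def[abs_def] split_def intro!: continuous_on_mult)
  moreover have "finite K" using E F by (simp add: K_def)
  ultimately show ?case
    by (intro separates_segmentsI[of K c' f']) simp_all
qed

lemma pos_def_sum_of_squares:
  fixes A :: "'i \<Rightarrow> 'i \<Rightarrow> real"
  assumes "finite I" "\<And>i j. A i j = A j i"
    and "\<And>v. \<exists>i\<in>I. v i \<noteq> 0 \<Longrightarrow> (\<Sum>i\<in>I. \<Sum>j\<in>I. v i * v j * A i j) > 0"
  shows "\<exists>b. \<forall>v. (\<Sum>i\<in>I. \<Sum>j\<in>I. v i * v j * A i j) = (\<Sum>k\<in>I. (\<Sum>i\<in>I. b k i * v i)\<^sup>2)"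
  using assms
proof (induction I arbitrary: A rule: finite_induct)
  case empty
  show ?case by simp
next
  case (insert r I)
  define a where "a = A r r"
  define B where "B i j = A i j - A r i * A r j / a" for i j
  have expand: "(\<Sum>i\<in>insert r I. \<Sum>j\<in>insert r I. v i * v j * A i j) =
      v r * v r * a + 2 * v r * (\<Sum>i\<in>I. A r i * v i) + (\<Sum>i\<in>I. \<Sum>j\<in>I. v i * v j * A i j)" for v
  proof -
    have "(\<Sum>i\<in>I. v i * v r * A i r) = v r * (\<Sum>i\<in>I. A r i * v i)"
      unfolding sum_distrib_left using insert.prems(1)[of _ r] by (intro sum.cong) simp_all
    moreover have "(\<Sum>j\<in>I. v r * v j * A r j) = v r * (\<Sum>i\<in>I. A r i * v i)"
      unfolding sum_distrib_left by (intro sum.cong) simp_all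
    ultimately show ?thesis
      using insert.hyps by (simp add: a_def sum.distrib)
  qed
  have "a > 0"
  proof -
    define v where "v i = (if i = r then 1 else 0 :: real)" for i
    have "v i = 0" if "i \<in> I" for i using that insert.hyps by (auto simp: v_def)
    then have "(\<Sum>i\<in>insert r I. \<Sum>j\<in>insert r I. v i * v j * A i j) = a"
      unfolding expand by (simp add: v_def)
    then show ?thesis
      using insert.prems(2)[of v] by (simp add: v_def)
  qed
  have complete: "(\<Sum>i\<in>insert r I. \<Sum>j\<in>insert r I. v i * v j * A i j) =
      a * (v r + (\<Sum>i\<in>I. A r i * v i) / a)\<^sup>2 + (\<Sum>i\<in>I. \<Sum>j\<in>I. v i * v j * B i j)" for v
  proof -
    have "(\<Sum>i\<in>I. \<Sum>j\<in>I. v i * v j * B i j) =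
        (\<Sum>i\<in>I. \<Sum>j\<in>I. v i * v j * A i j) - (\<Sum>i\<in>I. A r i * v i)\<^sup>2 / a"
      unfolding B_def power2_eq_square sum_product sum_divide_distrib sum_subtractf[symmetric]
      by (intro sum.cong refl) (simp add: right_diff_distrib mult_ac)
    moreover have "p * p * a + 2 * p * q + z = a * (p + q / a)\<^sup>2 + (z - q\<^sup>2 / a)" for p q z
      using \<open>a > 0\<close> by (simp add: power2_eq_square field_simps)
    ultimately show ?thesis
      unfolding expand by (simp only:)
  qed
  have "\<exists>b. \<forall>v. (\<Sum>i\<in>I. \<Sum>j\<in>I. v i * v j * B i j) = (\<Sum>k\<in>I. (\<Sum>i\<in>I. b k i * v i)\<^sup>2)"
  proof (rule insert.IH)
    show "B i j = B j i" for i j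
      using insert.prems(1)[of i j] by (simp add: B_def mult.commute)
    fix v :: "'i \<Rightarrow> real" assume v: "\<exists>i\<in>I. v i \<noteq> 0"
    define w where "w = v(r := - (\<Sum>i\<in>I. A r i * v i) / a)"
    have w: "w i = v i" if "i \<in> I" for i using that insert.hyps by (auto simp: w_def)
    have "(\<Sum>i\<in>insert r I. \<Sum>j\<in>insert r I. w i * w j * A i j) > 0"
      by (rule insert.prems(2)) (use v w in force)
    then show "(\<Sum>i\<in>I. \<Sum>j\<in>I. v i * v j * B i j) > 0"
      unfolding complete by (simp add: w) (simp add: w_def)
  qed
  then obtain b where b: "\<And>v. (\<Sum>i\<in>I. \<Sum>j\<in>I. v i * v j * B i j) = (\<Sum>k\<in>I. (\<Sum>i\<in>I. b k i * v i)\<^sup>2)"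
    by blast
  define b' where "b' k i = (if k = r then sqrt a * (if i = r then 1 else A r i / a) else if i = r then 0 else b k i)" for k i
  have "(\<Sum>i\<in>insert r I. b' r i * v i) = sqrt a * (v r + (\<Sum>i\<in>I. A r i * v i) / a)" for v
  proof -
    have "(\<Sum>i\<in>I. b' r i * v i) = sqrt a * ((\<Sum>i\<in>I. A r i * v i) / a)"
      unfolding sum_divide_distrib sum_distrib_left
      using insert.hyps by (intro sum.cong) (auto simp: b'_def)
    then show ?thesis using insert.hyps by (simp add: b'_def ring_distribs)
  qed
  then have r: "(\<Sum>i\<in>insert r I. b' r i * v i)\<^sup>2 = a * (v r + (\<Sum>i\<in>I. A r i * v i) / a)\<^sup>2" for v
    using \<open>a > 0\<close> by (simp add: power_mult_distrib)
  have k: "(\<Sum>i\<in>insert r I. b' k i * v i) = (\<Sum>i\<in>I. b k i * v i)" if "k \<in> I" for k v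
  proof -
    have "k \<noteq> r" using that insert.hyps by auto
    then have "(\<Sum>i\<in>I. b' k i * v i) = (\<Sum>i\<in>I. b k i * v i)"
      using insert.hyps by (intro sum.cong) (auto simp: b'_def)
    then show ?thesis using insert.hyps \<open>k \<noteq> r\<close> by (simp add: b'_def)
  qed
  have "(\<Sum>i\<in>insert r I. \<Sum>j\<in>insert r I. v i * v j * A i j) = (\<Sum>k\<in>insert r I. (\<Sum>i\<in>insert r I. b' k i * v i)\<^sup>2)" for v
  proof -
    have "(\<Sum>k\<in>insert r I. (\<Sum>i\<in>insert r I. b' k i * v i)\<^sup>2) =
        (\<Sum>i\<in>insert r I. b' r i * v i)\<^sup>2 + (\<Sum>k\<in>I. (\<Sum>i\<in>insert r I. b' k i * v i)\<^sup>2)"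
      using insert.hyps(1,2) by (rule sum.insert)
    also have "(\<Sum>k\<in>I. (\<Sum>i\<in>insert r I. b' k i * v i)\<^sup>2) = (\<Sum>k\<in>I. (\<Sum>i\<in>I. b k i * v i)\<^sup>2)"
      by (intro sum.cong refl) (simp only: k)
    finally show ?thesis unfolding complete r b by simp
  qed
  then show ?case by blast
qed

section \<open>Local representations\<close>

lemma lincomb_mono:
  assumes "finite F" "E \<subseteq> F"
  shows "lincomb E \<subseteq> lincomb F"
proof
  fix h assume "h \<in> lincomb E"
  then obtain v where h: "h = (\<lambda>x. \<Sum>f\<in>E. v f * f x)"
    by (auto simp: lincomb_def)
  show "h \<in> lincomb F"
    unfolding h using assms by (intro lincomb_sum lincomb_cmult lincomb_base) auto
qed

lemma segment_times_coord_lincomb: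
  fixes E :: "real ^ 'n \<Rightarrow> real"
  assumes "real_polynomial_function E"
  shows "\<exists>F. finite F \<and> (\<forall>u s. (\<lambda>x. E (u + s *\<^sub>R (x - u)) * (x - u) $ i) \<in> lincomb F)"
proof -
  obtain I c f where "separates_segments I c f E"
    using real_polynomial_segment_separation[OF assms] by blast
  note sep = separates_segmentsD[OF this]
  let ?F = "f ` I \<union> (\<lambda>k x. f k x * x $ i) ` I"
  have "finite ?F" using sep(1) by simp
  moreover have "(\<lambda>x. E (u + s *\<^sub>R (x - u)) * (x - u) $ i) \<in> lincomb ?F" for u s
  proof -
    have "(\<lambda>x. E (u + s *\<^sub>R (x - u)) * (x - u) $ i) =
        (\<lambda>x. \<Sum>k\<in>I. c k u s * (f k x * x $ i) - c k u s * u $ i * f k x)"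
      unfolding sep(4) sum_distrib_right by (intro ext sum.cong refl) (simp add: algebra_simps)
    also have "\<dots> \<in> lincomb ?F"
    proof (intro lincomb_sum lincomb_diff lincomb_cmult)
      fix k assume "k \<in> I"
      then show "f k \<in> lincomb ?F" "(\<lambda>x. f k x * x $ i) \<in> lincomb ?F"
        using lincomb_base[OF \<open>finite ?F\<close>] by blast+
    qed
    finally show ?thesis .
  qed
  ultimately show ?thesis by blast
qed

lemma sdp_representable_sos_concave:
  fixes g :: "real ^ 'n \<Rightarrow> real"
  assumes g: "real_polynomial_function g" and "sos_concave g"
  shows "sdp_representable {x. g x \<ge> 0}"
proof -
  obtain k :: nat and W :: "nat \<Rightarrow> 'n \<Rightarrow> real ^ 'n \<Rightarrow> real"
    where W: "\<And>l a. l < k \<Longrightarrow> real_polynomial_function (W l a)"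
      and hess: "\<And>x a b. (- hessian g x) $ a $ b = (\<Sum>l<k. W l a x * W l b x)"
    using assms(2) unfolding sos_concave_def sos_matrix_def by blast
  define F where "F l a = (SOME F. finite F \<and>
      (\<forall>u s. (\<lambda>x. W l a (u + s *\<^sub>R (x - u)) * (x - u) $ a) \<in> lincomb F))" for l a
  have F: "finite (F l a)" "(\<lambda>x. W l a (u + s *\<^sub>R (x - u)) * (x - u) $ a) \<in> lincomb (F l a)"
    if "l < k" for l a u s
    using someI_ex[OF segment_times_coord_lincomb[OF W[OF that]], of a a] unfolding F_def by blast+
  define \<Phi> where "\<Phi> = (\<Union>l<k. \<Union>a. F l a)"
  have "finite \<Phi>" using F(1) by (simp add: \<Phi>_def)
  define \<psi> where "\<psi> l u s x = (\<Sum>a\<in>UNIV. W l a (u + s *\<^sub>R (x - u)) * (x - u) $ a)" for l u s x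
  have \<psi>: "\<psi> l u s \<in> lincomb \<Phi>" if "l < k" for l u s
    unfolding \<psi>_def
  proof (rule lincomb_sum)
    fix a
    have "F l a \<subseteq> \<Phi>" using that by (auto simp: \<Phi>_def)
    then show "(\<lambda>x. W l a (u + s *\<^sub>R (x - u)) * (x - u) $ a) \<in> lincomb \<Phi>"
      using F(2)[OF that] lincomb_mono[OF \<open>finite \<Phi>\<close>] by blast
  qed
  have quad: "(x - u) \<bullet> (hessian g (u + s *\<^sub>R (x - u)) *v (x - u)) = - (\<Sum>l<k. (\<psi> l u s x)\<^sup>2)" for x u s
  proof -
    have hess': "hessian g z $ a $ b = - (\<Sum>l<k. W l a z * W l b z)" for z a b
      using hess[of z a b] by simp
    have "v \<bullet> (hessian g z *v v) = - (\<Sum>l<k. (\<Sum>a\<in>UNIV. W l a z * v $ a)\<^sup>2)" for v z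
    proof -
      have "v \<bullet> (hessian g z *v v) = - (\<Sum>a\<in>UNIV. \<Sum>b\<in>UNIV. \<Sum>l<k. (W l a z * v $ a) * (W l b z * v $ b))"
        unfolding quadratic_form_eq hess' by (simp add: sum_distrib_left sum_negf mult_ac)
      also have "\<dots> = - (\<Sum>l<k. (\<Sum>a\<in>UNIV. W l a z * v $ a)\<^sup>2)"
        by (simp only: power2_eq_square sum_product sum.swap[of _ "{..<k}"])
      finally show ?thesis .
    qed
    then show ?thesis unfolding \<psi>_def .
  qed
  have "sdp_representable (UNIV \<inter> {x. g x \<ge> 0})"
  proof (rule sdp_representable_lift[of "{(\<lambda>_. 1, \<Phi>)}"])
    fix u P y
    assume mass: "(\<Sum>t\<in>P. y t) = 1" and bary: "(\<Sum>t\<in>P. y t *\<^sub>R t) = u"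
      and pos: "\<And>w \<Phi>' \<psi>. (w, \<Phi>') \<in> {(\<lambda>_. 1, \<Phi>)} \<Longrightarrow> \<psi> \<in> lincomb \<Phi>' \<Longrightarrow> (\<Sum>t\<in>P. y t * (w t * (\<psi> t)\<^sup>2)) \<ge> 0"
    have "(\<Sum>t\<in>P. y t * ((t - u) \<bullet> (hessian g (u + s *\<^sub>R (t - u)) *v (t - u)))) \<le> 0" for s
    proof -
      have "(\<Sum>l<k. \<Sum>t\<in>P. y t * (1 * (\<psi> l u s t)\<^sup>2)) \<ge> 0"
        by (intro sum_nonneg pos[of "\<lambda>_. 1" \<Phi>] \<psi>) simp_all
      then show ?thesis
        unfolding quad by (simp add: sum_distrib_left sum_negf sum.swap[of _ P])
    qed
    then show "(\<Sum>t\<in>P. y t * g t) \<le> g u"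
      by (intro jensen_functional[OF g mass bary])
  qed (simp_all add: \<open>finite \<Phi>\<close> sdp_representable_UNIV)
  then show ?thesis by simp
qed

lemma eventually_nhds_cube:
  fixes p :: "real ^ 'n"
  assumes "eventually Q (nhds p)"
  shows "\<exists>d>0. \<forall>x. (\<forall>i. \<bar>x $ i - p $ i\<bar> \<le> d) \<longrightarrow> Q x"
proof -
  obtain e where "e > 0" and e: "\<And>x. dist x p < e \<Longrightarrow> Q x"
    using assms unfolding eventually_nhds_metric by blast
  define d where "d = e / (real CARD('n) + 1)"
  have "d > 0" using \<open>e > 0\<close> by (simp add: d_def)
  moreover have "Q x" if "\<forall>i. \<bar>x $ i - p $ i\<bar> \<le> d" for x
  proof (rule e)
    have "dist x p \<le> (\<Sum>i\<in>UNIV. \<bar>(x - p) $ i\<bar>)"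
      unfolding dist_norm by (rule norm_le_l1_cart)
    also have "\<dots> \<le> (\<Sum>i\<in>(UNIV :: 'n set). d)"
      using that by (intro sum_mono) simp
    also have "\<dots> = real CARD('n) * d" by simp
    also have "\<dots> < (real CARD('n) + 1) * d" using \<open>d > 0\<close> by simp
    also have "\<dots> = e" by (simp add: d_def)
    finally show "dist x p < e" .
  qed
  ultimately show ?thesis by blast
qed

lemma ball_subset_cube:
  fixes p :: "real ^ 'n"
  shows "ball p d \<subseteq> {x. \<forall>i. \<bar>x $ i - p $ i\<bar> \<le> d}"
proof (intro subsetI CollectI allI)
  fix x i assume "x \<in> ball p d"
  then show "\<bar>x $ i - p $ i\<bar> \<le> d"
    using component_le_norm_cart[of "x - p" i] by (simp add: dist_norm norm_minus_commute)
qed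

lemma continuous_real_polynomial_function:
  "real_polynomial_function (f :: real ^ 'n \<Rightarrow> real) \<Longrightarrow> continuous_on S f"
  by (meson real_polynomial_has_derivative has_derivative_continuous continuous_at_imp_continuous_on)

lemma eventually_continuous_less:
  fixes f :: "'a::topological_space \<Rightarrow> real"
  assumes "continuous_on UNIV f" "f p < c"
  shows "\<forall>\<^sub>F x in nhds p. f x < c"
proof -
  have "open {x. f x < c}" using assms(1) by (intro open_Collect_less continuous_intros)
  then show ?thesis using assms(2) eventually_nhds by blast
qed

text \<open>
  This takes the place of a Positivstellensatz: near a single point, the remainder \<open>E\<close> is small and
  the weights \<open>1\<close> and \<open>\<eta> \<plusminus> (f k - f k p)\<close> suffice.
\<close>

lemma local_certificate:
  fixes E :: "real ^ 'n \<Rightarrow> real"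
  assumes poly: "real_polynomial_function E" and "E p = 0" and "\<epsilon> > 0"
  shows "\<exists>W. finite W \<and> (\<forall>\<^sub>F x in nhds p. \<forall>w\<in>W. w x \<ge> 0) \<and>
    (\<forall>\<^sub>F u in nhds p. \<forall>s\<in>{0..1}. (\<lambda>x. \<epsilon> + E (u + s *\<^sub>R (x - u))) \<in> conecomb W)"
proof -
  obtain I c f where "separates_segments I c f E"
    using real_polynomial_segment_separation[OF poly] by blast
  note sep = separates_segmentsD[OF this]
  have "\<exists>C. \<forall>z\<in>cball p 1 \<times> {0..1}. \<bar>case_prod (c k) z\<bar> \<le> C" if "k \<in> I" for k
  proof -
    have "compact (cball p 1 \<times> {0..1::real})" by (intro compact_Times) auto
    moreover have "continuous_on (cball p 1 \<times> {0..1}) (case_prod (c k))"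
      using sep(2)[OF that] continuous_on_subset by blast
    ultimately have "bounded (case_prod (c k) ` (cball p 1 \<times> {0..1}))"
      by (intro compact_imp_bounded compact_continuous_image)
    then show ?thesis by (auto simp: bounded_iff)
  qed
  then obtain C where C: "\<And>k u s. k \<in> I \<Longrightarrow> u \<in> cball p 1 \<Longrightarrow> s \<in> {0..1} \<Longrightarrow> \<bar>c k u s\<bar> \<le> C k"
    by (metis SigmaI case_prod_conv)
  define M where "M = (\<Sum>k\<in>I. \<bar>C k\<bar>) + 1"
  have "M > 0" by (simp add: M_def add_nonneg_pos sum_nonneg)
  define \<eta> where "\<eta> = \<epsilon> / (2 * M)"
  have "\<eta> > 0" using \<open>M > 0\<close> \<open>\<epsilon> > 0\<close> by (simp add: \<eta>_def)
  define wp where "wp k x = \<eta> + (f k x - f k p)" for k x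
  define wm where "wm k x = \<eta> - (f k x - f k p)" for k x
  define W where "W = insert (\<lambda>_. 1) (wp ` I \<union> wm ` I)"
  have "finite W" using sep(1) by (simp add: W_def)
  moreover have "\<forall>\<^sub>F x in nhds p. \<forall>w\<in>W. w x \<ge> 0"
  proof -
    have "\<forall>\<^sub>F x in nhds p. \<bar>f k x - f k p\<bar> < \<eta>" if "k \<in> I" for k
      using \<open>\<eta> > 0\<close> by (intro eventually_continuous_less continuous_intros sep(3)[OF that]) simp
    then have "\<forall>\<^sub>F x in nhds p. \<forall>k\<in>I. \<bar>f k x - f k p\<bar> < \<eta>"
      using sep(1) by (intro eventually_ball_finite) auto
    then show ?thesis
      by eventually_elim (force simp: W_def wp_def wm_def)
  qed
  moreover have "\<forall>\<^sub>F u in nhds p. \<forall>s\<in>{0..1}. (\<lambda>x. \<epsilon> + E (u + s *\<^sub>R (x - u))) \<in> conecomb W"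
  proof -
    obtain d where "d > 0" and d: "\<And>x. dist x p < d \<Longrightarrow> \<bar>E x\<bar> < \<epsilon> / 2"
    proof -
      have "\<forall>\<^sub>F x in nhds p. \<bar>E x\<bar> < \<epsilon> / 2"
        using \<open>\<epsilon> > 0\<close> \<open>E p = 0\<close>
        by (intro eventually_continuous_less continuous_intros continuous_real_polynomial_function poly) simp
      then show thesis using that unfolding eventually_nhds_metric by blast
    qed
    have "(\<lambda>x. \<epsilon> + E (u + s *\<^sub>R (x - u))) \<in> conecomb W"
      if u: "dist u p < min d 1" and s: "s \<in> {0..1}" for u s
    proof -
      define cp where "cp k = max (c k u s) 0" for k
      define cm where "cm k = max (- c k u s) 0" for k
      define r where "r = \<epsilon> + E (u + s *\<^sub>R (p - u)) - \<eta> * (\<Sum>k\<in>I. \<bar>c k u s\<bar>)"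
      have "dist (u + s *\<^sub>R (p - u)) p \<le> dist u p"
      proof -
        have "u + s *\<^sub>R (p - u) - p = (1 - s) *\<^sub>R (u - p)" by (simp add: algebra_simps)
        then show ?thesis
          using s by (simp add: dist_norm mult_left_le_one_le)
      qed
      then have "\<bar>E (u + s *\<^sub>R (p - u))\<bar> < \<epsilon> / 2" using u by (intro d) simp
      moreover have "\<eta> * (\<Sum>k\<in>I. \<bar>c k u s\<bar>) \<le> \<epsilon> / 2"
      proof -
        have "(\<Sum>k\<in>I. \<bar>c k u s\<bar>) \<le> (\<Sum>k\<in>I. \<bar>C k\<bar>)"
          using C[of _ u s] u s by (intro sum_mono) (force simp: dist_commute)
        then have "\<eta> * (\<Sum>k\<in>I. \<bar>c k u s\<bar>) \<le> \<eta> * M"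
          using \<open>\<eta> > 0\<close> by (intro mult_left_mono) (auto simp: M_def)
        also have "\<dots> = \<epsilon> / 2" using \<open>M > 0\<close> by (simp add: \<eta>_def)
        finally show ?thesis .
      qed
      ultimately have "r \<ge> 0" unfolding r_def by linarith
      have "(\<lambda>x. \<epsilon> + E (u + s *\<^sub>R (x - u))) =
          (\<lambda>x. r * 1 + (\<Sum>k\<in>I. cp k * wp k x + cm k * wm k x))"
      proof
        fix x
        have "cp k * wp k x + cm k * wm k x = \<eta> * \<bar>c k u s\<bar> + (c k u s * f k x - c k u s * f k p)" for k
          by (cases "c k u s \<ge> 0") (simp_all add: cp_def cm_def wp_def wm_def algebra_simps)
        then have "(\<Sum>k\<in>I. cp k * wp k x + cm k * wm k x) =
            \<eta> * (\<Sum>k\<in>I. \<bar>c k u s\<bar>) + (E (u + s *\<^sub>R (x - u)) - E (u + s *\<^sub>R (p - u)))"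
          by (simp add: sum.distrib sum_subtractf sum_distrib_left sep(4))
        then show "\<epsilon> + E (u + s *\<^sub>R (x - u)) = r * 1 + (\<Sum>k\<in>I. cp k * wp k x + cm k * wm k x)"
          by (simp add: r_def)
      qed
      also have "\<dots> \<in> conecomb W"
      proof (intro conecomb_add conecomb_sum conecomb_cmult \<open>r \<ge> 0\<close>)
        show "(\<lambda>_. 1) \<in> conecomb W" by (rule conecomb_base[OF \<open>finite W\<close>]) (simp add: W_def)
        fix k assume "k \<in> I"
        then show "wp k \<in> conecomb W" "wm k \<in> conecomb W"
          by (auto intro!: conecomb_base[OF \<open>finite W\<close>]) (auto simp: W_def)
        show "cp k \<ge> 0" "cm k \<ge> 0" by (simp_all add: cp_def cm_def)
      qed
      finally show ?thesis .
    qed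
    then show ?thesis
      unfolding eventually_nhds_metric using \<open>d > 0\<close> by (intro exI[of _ "min d 1"]) auto
  qed
  ultimately show ?thesis by blast
qed

lemma conecomb_weighted_nonneg:
  fixes y :: "'x \<Rightarrow> real"
  assumes "q \<in> conecomb W" and "\<And>w. w \<in> W \<Longrightarrow> (\<Sum>t\<in>P. y t * (w t * h t)) \<ge> 0"
  shows "(\<Sum>t\<in>P. y t * (q t * h t)) \<ge> 0"
proof -
  obtain v where q: "q = (\<lambda>x. \<Sum>w\<in>W. v w * w x)" and "\<forall>w. v w \<ge> 0"
    using assms(1) by (auto simp: conecomb_def)
  have "(\<Sum>t\<in>P. y t * (q t * h t)) = (\<Sum>w\<in>W. v w * (\<Sum>t\<in>P. y t * (w t * h t)))"
    unfolding q by (simp add: sum_distrib_left sum_distrib_right mult_ac sum.swap[of _ P])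
  then show ?thesis
    using \<open>\<forall>w. v w \<ge> 0\<close> assms(2) by (auto intro!: sum_nonneg)
qed


lemma sdp_representable_strongly_concave_local:
  fixes G :: "real ^ 'n \<Rightarrow> real"
  assumes poly: "real_polynomial_function G" and "c > 0"
    and conc: "\<And>v. c * (v \<bullet> v) \<le> - (v \<bullet> (hessian G p *v v))"
  shows "\<exists>d0>0. \<forall>d. d \<le> d0 \<longrightarrow> sdp_representable ({x. \<forall>i. \<bar>x $ i - p $ i\<bar> \<le> d} \<inter> {x. G x \<ge> 0})"
proof -
  define E where "E i j x = hessian G p $ i $ j - hessian G x $ i $ j" for i j x
  define \<epsilon> where "\<epsilon> = c / (2 * real CARD('n))"
  have "\<epsilon> > 0" using \<open>c > 0\<close> by (simp add: \<epsilon>_def)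
  have E: "real_polynomial_function (E i j)" "real_polynomial_function (\<lambda>x. - E i j x)" "E i j p = 0" for i j
    unfolding E_def[abs_def]
    by (auto intro!: real_polynomial_function_diff real_polynomial_function_minus real_polynomial_hessian poly)
  define certifies where "certifies W F \<longleftrightarrow> finite W \<and> (\<forall>\<^sub>F x in nhds p. \<forall>w\<in>W. w x \<ge> 0) \<and>
    (\<forall>\<^sub>F u in nhds p. \<forall>s\<in>{0..1}. (\<lambda>x. \<epsilon> + F (u + s *\<^sub>R (x - u))) \<in> conecomb W)"
    for W and F :: "real ^ 'n \<Rightarrow> real"
  have "\<exists>W. certifies W (E i j)" "\<exists>W. certifies W (\<lambda>x. - E i j x)" for i j
    unfolding certifies_def
    using local_certificate[OF E(1) E(3) \<open>\<epsilon> > 0\<close>, of i j] local_certificate[OF E(2) _ \<open>\<epsilon> > 0\<close>, of i j p] E(3)[of i j]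
    by simp_all
  then obtain W1 W2 where W1: "\<And>i j. certifies (W1 i j) (E i j)" and W2: "\<And>i j. certifies (W2 i j) (\<lambda>x. - E i j x)"
    by metis
  define W where "W = insert (\<lambda>_. 1) (\<Union>i. \<Union>j. W1 i j \<union> W2 i j)"
  have "finite W" using W1 W2 by (auto simp: W_def certifies_def)
  have "W1 i j \<subseteq> W" "W2 i j \<subseteq> W" for i j by (auto simp: W_def)
  then have mono: "conecomb (W1 i j) \<subseteq> conecomb W" "conecomb (W2 i j) \<subseteq> conecomb W" for i j
    by (simp_all add: conecomb_mono \<open>finite W\<close>)
  have "\<forall>\<^sub>F x in nhds p. \<forall>i j. (\<forall>w\<in>W1 i j. w x \<ge> 0) \<and> (\<forall>w\<in>W2 i j. w x \<ge> 0)"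
    using W1 W2 by (intro eventually_all_finite eventually_conj) (auto simp: certifies_def)
  then have ev1: "\<forall>\<^sub>F x in nhds p. \<forall>w\<in>W. w x \<ge> 0"
    by eventually_elim (auto simp: W_def)
  have "\<forall>\<^sub>F u in nhds p. \<forall>s\<in>{0..1}. (\<lambda>x. \<epsilon> + E i j (u + s *\<^sub>R (x - u))) \<in> conecomb W" for i j
    by (rule eventually_mono[OF W1[unfolded certifies_def, THEN conjunct2, THEN conjunct2, of i j]])
      (use mono(1)[of i j] in blast)
  moreover have "\<forall>\<^sub>F u in nhds p. \<forall>s\<in>{0..1}. (\<lambda>x. \<epsilon> - E i j (u + s *\<^sub>R (x - u))) \<in> conecomb W" for i j
    by (rule eventually_mono[OF W2[unfolded certifies_def, THEN conjunct2, THEN conjunct2, of i j]])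
      (use mono(2)[of i j] in auto)
  ultimately have ev2: "\<forall>\<^sub>F u in nhds p. \<forall>i j. \<forall>s\<in>{0..1}. (\<lambda>x. \<epsilon> + E i j (u + s *\<^sub>R (x - u))) \<in> conecomb W \<and>
      (\<lambda>x. \<epsilon> - E i j (u + s *\<^sub>R (x - u))) \<in> conecomb W"
    unfolding ball_conj_distrib by (intro eventually_all_finite eventually_conj)
  obtain d0 where "d0 > 0" and d0: "\<And>x. \<forall>i. \<bar>x $ i - p $ i\<bar> \<le> d0 \<Longrightarrow> (\<forall>w\<in>W. w x \<ge> 0) \<and>
      (\<forall>i j. \<forall>s\<in>{0..1}. (\<lambda>z. \<epsilon> + E i j (x + s *\<^sub>R (z - x))) \<in> conecomb W \<and>
        (\<lambda>z. \<epsilon> - E i j (x + s *\<^sub>R (z - x))) \<in> conecomb W)"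
    using eventually_nhds_cube[OF eventually_conj[OF ev1 ev2]] by metis

  define A where "A i j = - (hessian G p $ i $ j + hessian G p $ j $ i) / 2 - (if i = j then c / 2 else 0)" for i j
  have A: "(\<Sum>i\<in>UNIV. \<Sum>j\<in>UNIV. v i * v j * A i j) =
      - (\<Sum>i\<in>UNIV. \<Sum>j\<in>UNIV. v i * v j * hessian G p $ i $ j) - c / 2 * (\<Sum>i\<in>UNIV. v i * v i)" for v
  proof -
    have "(\<Sum>i\<in>UNIV. \<Sum>j\<in>UNIV. v i * v j * hessian G p $ j $ i) = (\<Sum>i\<in>UNIV. \<Sum>j\<in>UNIV. v i * v j * hessian G p $ i $ j)"
      by (subst sum.swap) (simp add: mult_ac)
    moreover have "(\<Sum>i\<in>UNIV. \<Sum>j\<in>UNIV. v i * v j * A i j) =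
        (\<Sum>i\<in>UNIV. \<Sum>j\<in>UNIV. - (v i * v j * hessian G p $ i $ j) / 2 - (v i * v j * hessian G p $ j $ i) / 2
          - (if i = j then c / 2 * (v i * v i) else 0))"
      by (intro sum.cong refl) (auto simp: A_def field_simps)
    ultimately show ?thesis
      by (simp add: sum_subtractf sum_negf sum_divide_distrib[symmetric] sum_distrib_left[symmetric])
  qed
  have "\<exists>b. \<forall>v. (\<Sum>i\<in>UNIV. \<Sum>j\<in>UNIV. v i * v j * A i j) = (\<Sum>k\<in>(UNIV :: 'n set). (\<Sum>i\<in>UNIV. b k i * v i)\<^sup>2)"
  proof (rule pos_def_sum_of_squares)
    fix v :: "'n \<Rightarrow> real" assume "\<exists>i\<in>UNIV. v i \<noteq> 0"
    then have "(\<chi> i. v i) \<noteq> 0" by (auto simp: vec_eq_iff)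
    then have "(\<chi> i. v i) \<bullet> (\<chi> i. v i) > 0" by simp
    then have "c / 2 * (\<Sum>i\<in>UNIV. v i * v i) > 0" using \<open>c > 0\<close> by (simp add: inner_vec_def)
    moreover have "c * (\<Sum>i\<in>UNIV. v i * v i) \<le> - (\<Sum>i\<in>UNIV. \<Sum>j\<in>UNIV. v i * v j * hessian G p $ i $ j)"
      using conc[of "\<chi> i. v i"] unfolding quadratic_form_eq by (simp add: inner_vec_def)
    ultimately show "(\<Sum>i\<in>UNIV. \<Sum>j\<in>UNIV. v i * v j * A i j) > 0"
      unfolding A by simp
  qed (auto simp: A_def)
  then obtain b where b: "\<And>v. (\<Sum>i\<in>UNIV. \<Sum>j\<in>UNIV. v i * v j * A i j) = (\<Sum>k\<in>(UNIV :: 'n set). (\<Sum>i\<in>UNIV. b k i * v i)\<^sup>2)"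
    by blast

  have split: "- (v \<bullet> (hessian G z *v v)) = (\<Sum>k\<in>UNIV. (\<Sum>i\<in>UNIV. b k i * v $ i)\<^sup>2) +
      (\<Sum>i\<in>UNIV. \<Sum>j\<in>UNIV. (\<epsilon> + E i j z) * ((v $ i + v $ j) / 2)\<^sup>2 + (\<epsilon> - E i j z) * ((v $ i - v $ j) / 2)\<^sup>2)" for v z
  proof -
    have "(\<epsilon> + E i j z) * ((v $ i + v $ j) / 2)\<^sup>2 + (\<epsilon> - E i j z) * ((v $ i - v $ j) / 2)\<^sup>2 =
        \<epsilon> / 2 * (v $ i * v $ i) + \<epsilon> / 2 * (v $ j * v $ j) + v $ i * v $ j * E i j z" for i j
      by (simp add: power2_eq_square field_simps)
    moreover have "(\<Sum>i\<in>UNIV. \<Sum>j\<in>(UNIV :: 'n set). e * f i) = real CARD('n) * e * (\<Sum>i\<in>UNIV. f i)"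
      "(\<Sum>i\<in>(UNIV :: 'n set). \<Sum>j\<in>UNIV. e * f j) = real CARD('n) * e * (\<Sum>j\<in>UNIV. f j)"
      for e and f :: "'n \<Rightarrow> real"
      by (simp_all add: sum_distrib_left[symmetric] mult.assoc)
    ultimately have "(\<Sum>i\<in>UNIV. \<Sum>j\<in>UNIV. (\<epsilon> + E i j z) * ((v $ i + v $ j) / 2)\<^sup>2 + (\<epsilon> - E i j z) * ((v $ i - v $ j) / 2)\<^sup>2) =
        real CARD('n) * \<epsilon> * (\<Sum>i\<in>UNIV. v $ i * v $ i) + (\<Sum>i\<in>UNIV. \<Sum>j\<in>UNIV. v $ i * v $ j * E i j z)"
      by (simp only: sum.distrib)
    also have "real CARD('n) * \<epsilon> = c / 2" by (simp add: \<epsilon>_def)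
    also have "(\<Sum>i\<in>UNIV. \<Sum>j\<in>UNIV. v $ i * v $ j * E i j z) =
        (\<Sum>i\<in>UNIV. \<Sum>j\<in>UNIV. v $ i * v $ j * hessian G p $ i $ j) - v \<bullet> (hessian G z *v v)"
      unfolding quadratic_form_eq E_def by (simp add: right_diff_distrib sum_subtractf)
    finally show ?thesis
      unfolding b[symmetric] A by simp
  qed

  define \<Phi> where "\<Phi> = insert (\<lambda>_. 1) (range (\<lambda>i (x :: real ^ 'n). x $ i))"
  have "finite \<Phi>" by (simp add: \<Phi>_def)
  have coord: "(\<lambda>x. (x - u) $ i) \<in> lincomb \<Phi>" for u i
  proof -
    have "(\<lambda>x. x $ i - u $ i * 1) \<in> lincomb \<Phi>"
      by (intro lincomb_diff lincomb_cmult lincomb_base[OF \<open>finite \<Phi>\<close>]) (auto simp: \<Phi>_def)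
    then show ?thesis by simp
  qed

  have "sdp_representable ({x. \<forall>i. \<bar>x $ i - p $ i\<bar> \<le> d} \<inter> {x. G x \<ge> 0})" if "d \<le> d0" for d
  proof (rule sdp_representable_lift[of "(\<lambda>w. (w, \<Phi>)) ` W", OF _ _ sdp_representable_box])
    have cube: "\<forall>i. \<bar>x $ i - p $ i\<bar> \<le> d0" if "x \<in> {x. \<forall>i. \<bar>x $ i - p $ i\<bar> \<le> d}" for x
      using that \<open>d \<le> d0\<close> by (auto intro: order_trans)
    show "w x \<ge> 0" if "(w, \<Psi>) \<in> (\<lambda>w. (w, \<Phi>)) ` W" "x \<in> {x. \<forall>i. \<bar>x $ i - p $ i\<bar> \<le> d}" for w \<Psi> x
      using d0[OF cube[OF that(2)]] that(1) by auto
    fix u P y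
    assume "u \<in> {x. \<forall>i. \<bar>x $ i - p $ i\<bar> \<le> d}"
      and mass: "(\<Sum>t\<in>P. y t) = 1" and bary: "(\<Sum>t\<in>P. y t *\<^sub>R t) = u"
      and pos: "\<And>w \<Psi> \<psi>. (w, \<Psi>) \<in> (\<lambda>w. (w, \<Phi>)) ` W \<Longrightarrow> \<psi> \<in> lincomb \<Psi> \<Longrightarrow> (\<Sum>t\<in>P. y t * (w t * (\<psi> t)\<^sup>2)) \<ge> 0"
    note u = d0[OF cube[OF this(1)]]
    have pos': "(\<Sum>t\<in>P. y t * (q t * (\<psi> t)\<^sup>2)) \<ge> 0" if "q \<in> conecomb W" "\<psi> \<in> lincomb \<Phi>" for q \<psi>
      using that(1) by (rule conecomb_weighted_nonneg) (use pos that(2) in blast)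
    have one: "(\<lambda>_. 1) \<in> conecomb W"
      by (rule conecomb_base[OF \<open>finite W\<close>]) (simp add: W_def)
    have "(\<Sum>t\<in>P. y t * ((t - u) \<bullet> (hessian G (u + s *\<^sub>R (t - u)) *v (t - u)))) \<le> 0"
      if "0 \<le> s" "s \<le> 1" for s
    proof -
      have s: "s \<in> {0..1}" using that by simp
      have cert: "(\<lambda>x. \<epsilon> + E i j (u + s *\<^sub>R (x - u))) \<in> conecomb W" "(\<lambda>x. \<epsilon> - E i j (u + s *\<^sub>R (x - u))) \<in> conecomb W" for i j
        using u s by auto
      have lin: "(\<lambda>t. \<Sum>i\<in>UNIV. b k i * (t - u) $ i) \<in> lincomb \<Phi>"
        "(\<lambda>t. ((t - u) $ i + (t - u) $ j) / 2) \<in> lincomb \<Phi>"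
        "(\<lambda>t. ((t - u) $ i - (t - u) $ j) / 2) \<in> lincomb \<Phi>" for k i j
        using lincomb_cmult[OF lincomb_add[OF coord coord], of "1 / 2" u i u j]
          lincomb_cmult[OF lincomb_diff[OF coord coord], of "1 / 2" u i u j]
        by (auto intro!: lincomb_sum lincomb_cmult coord simp del: vector_minus_component)
      have "- (\<Sum>t\<in>P. y t * ((t - u) \<bullet> (hessian G (u + s *\<^sub>R (t - u)) *v (t - u)))) =
          (\<Sum>t\<in>P. y t * - ((t - u) \<bullet> (hessian G (u + s *\<^sub>R (t - u)) *v (t - u))))"
        by (simp add: sum_negf)
      also have "\<dots> = (\<Sum>k\<in>UNIV. \<Sum>t\<in>P. y t * (1 * (\<Sum>i\<in>UNIV. b k i * (t - u) $ i)\<^sup>2)) +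
          (\<Sum>i\<in>UNIV. \<Sum>j\<in>UNIV. (\<Sum>t\<in>P. y t * ((\<epsilon> + E i j (u + s *\<^sub>R (t - u))) * (((t - u) $ i + (t - u) $ j) / 2)\<^sup>2)) +
            (\<Sum>t\<in>P. y t * ((\<epsilon> - E i j (u + s *\<^sub>R (t - u))) * (((t - u) $ i - (t - u) $ j) / 2)\<^sup>2)))"
        unfolding split distrib_left sum_distrib_left sum.distrib sum.swap[of _ P] by simp
      also have "\<dots> \<ge> 0"
        by (intro add_nonneg_nonneg sum_nonneg pos' cert lin one)
      finally show ?thesis by simp
    qed
    then show "(\<Sum>t\<in>P. y t * G t) \<le> G u"
      by (intro jensen_functional[OF poly mass bary])
  qed (use \<open>finite W\<close> \<open>finite \<Phi>\<close> in auto)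
  then show ?thesis using \<open>d0 > 0\<close> by blast
qed


lemma positive_combination_on_compact:
  fixes q l :: "'a::topological_space \<Rightarrow> real"
  assumes "compact K" "continuous_on K q" "continuous_on K l"
    and "\<And>v. v \<in> K \<Longrightarrow> l v \<ge> 0" and "\<And>v. v \<in> K \<Longrightarrow> l v = 0 \<Longrightarrow> q v > 0"
  shows "\<exists>M c. M \<ge> 0 \<and> c > 0 \<and> (\<forall>v\<in>K. c \<le> q v + M * l v)"
proof -
  have "\<exists>M\<ge>0. \<forall>v\<in>K. q v + M * l v > 0"
  proof (cases "{v \<in> K. q v \<le> 0} = {}")
    case True
    then show ?thesis by (intro exI[of _ 0]) force
  next
    case False
    have "closedin (top_of_set K) {v \<in> K. q v \<le> 0}"
      using continuous_closedin_preimage[OF assms(2) closed_atMost[of 0]] by (simp add: vimage_def Int_def)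
    then have K': "compact {v \<in> K. q v \<le> 0}"
      using closedin_compact[OF \<open>compact K\<close>] by simp
    obtain v0 where v0: "v0 \<in> K" "q v0 \<le> 0" and l0: "\<And>v. v \<in> K \<Longrightarrow> q v \<le> 0 \<Longrightarrow> l v0 \<le> l v"
      using continuous_attains_inf[OF K' False continuous_on_subset[OF assms(3)]] by auto
    have "l v0 > 0" using assms(4,5)[OF v0(1)] v0(2) by fastforce
    obtain w0 where w0: "w0 \<in> K" "\<And>v. v \<in> K \<Longrightarrow> q w0 \<le> q v"
      using continuous_attains_inf[OF assms(1) _ assms(2)] v0 by auto
    define M where "M = (\<bar>q w0\<bar> + 1) / l v0"
    have "M \<ge> 0" using \<open>l v0 > 0\<close> by (simp add: M_def)
    moreover have "q v + M * l v > 0" if "v \<in> K" for v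
    proof (cases "q v \<le> 0")
      case True
      have "\<bar>q w0\<bar> + 1 = M * l v0" using \<open>l v0 > 0\<close> by (simp add: M_def)
      also have "\<dots> \<le> M * l v" using l0[OF that True] \<open>M \<ge> 0\<close> by (rule mult_left_mono)
      finally show ?thesis using w0(2)[OF that] by linarith
    next
      case False
      then show ?thesis using \<open>M \<ge> 0\<close> assms(4)[OF that] by (simp add: add_pos_nonneg)
    qed
    ultimately show ?thesis by blast
  qed
  then obtain M where "M \<ge> 0" and M: "\<And>v. v \<in> K \<Longrightarrow> q v + M * l v > 0" by blast
  show ?thesis
  proof (cases "K = {}")
    case True
    then show ?thesis by (intro exI[of _ 0] exI[of _ 1]) simp
  next
    case False
    have "continuous_on K (\<lambda>v. q v + M * l v)" by (intro continuous_intros assms)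
    then obtain v1 where "v1 \<in> K" "\<And>v. v \<in> K \<Longrightarrow> q v1 + M * l v1 \<le> q v + M * l v"
      using continuous_attains_inf[OF assms(1) False] by blast
    then show ?thesis using \<open>M \<ge> 0\<close> M by blast
  qed
qed

lemma partial_deriv_mult:
  assumes "real_polynomial_function f" "real_polynomial_function g"
  shows "partial_deriv i (\<lambda>x. f x * g x) x = partial_deriv i f x * g x + f x * partial_deriv i g x"
  using DERIV_mult[OF real_polynomial_has_partial_deriv[OF assms(1), of x i] real_polynomial_has_partial_deriv[OF assms(2), of x i]]
  unfolding partial_deriv_def[of i "\<lambda>x. f x * g x"] by (auto dest: DERIV_imp_deriv)

lemma partial_deriv_diff_cmult:
  assumes "real_polynomial_function f" "real_polynomial_function g"
  shows "partial_deriv i (\<lambda>x. f x - c * g x) x = partial_deriv i f x - c * partial_deriv i g x"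
  using DERIV_diff[OF real_polynomial_has_partial_deriv[OF assms(1), of x i]
      DERIV_cmult[OF real_polynomial_has_partial_deriv[OF assms(2), of x i], of c]]
  unfolding partial_deriv_def[of i "\<lambda>x. f x - c * g x"] by (auto dest: DERIV_imp_deriv)

text \<open>
  At a zero \<open>p\<close> of \<open>g\<close>, subtracting a multiple of \<open>g\<^sup>2\<close> changes the Hessian only by a multiple of
  the squared gradient, which repairs the missing concavity in the normal direction; near \<open>p\<close> the
  factor \<open>1 - M / 2 * g\<close> is positive, so the sign of \<open>g\<close> is kept.
\<close>

lemma quasi_concave_local_replacement:
  fixes g :: "real ^ 'n \<Rightarrow> real"
  assumes g: "real_polynomial_function g" and "g p = 0"
    and strict: "\<And>v. v \<noteq> 0 \<Longrightarrow> v \<bullet> gradient g p = 0 \<Longrightarrow> - (v \<bullet> (hessian g p *v v)) > 0"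
  shows "\<exists>G c. real_polynomial_function G \<and> c > 0 \<and> (\<forall>v. c * (v \<bullet> v) \<le> - (v \<bullet> (hessian G p *v v))) \<and>
    (\<forall>\<^sub>F x in nhds p. g x \<ge> 0 \<longleftrightarrow> G x \<ge> 0)"
proof -
  have "\<exists>M c. M \<ge> 0 \<and> c > 0 \<and> (\<forall>v\<in>sphere 0 1. c \<le> - (v \<bullet> (hessian g p *v v)) + M * (v \<bullet> gradient g p)\<^sup>2)"
  proof (rule positive_combination_on_compact)
    show "- (v \<bullet> (hessian g p *v v)) > 0" if "v \<in> sphere 0 1" "(v \<bullet> gradient g p)\<^sup>2 = 0" for v
      using that by (intro strict) auto
    show "continuous_on (sphere 0 1) (\<lambda>v. - (v \<bullet> (hessian g p *v v)))"
      by (intro continuous_intros linear_continuous_on matrix_vector_mul_bounded_linear)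
  qed (auto intro!: continuous_intros)
  then obtain M c where "c > 0" and Mc: "\<And>v. v \<in> sphere 0 1 \<Longrightarrow> c \<le> - (v \<bullet> (hessian g p *v v)) + M * (v \<bullet> gradient g p)\<^sup>2"
    by blast
  have bound: "c * (v \<bullet> v) \<le> - (v \<bullet> (hessian g p *v v)) + M * (v \<bullet> gradient g p)\<^sup>2" for v
  proof (cases "v = 0")
    case False
    define w where "w = (1 / norm v) *\<^sub>R v"
    have v: "v = norm v *\<^sub>R w" using False by (simp add: w_def)
    have "w \<in> sphere 0 1" using False by (simp add: w_def)
    from mult_left_mono[OF Mc[OF this], of "(norm v)\<^sup>2"]
    have "(norm v)\<^sup>2 * c \<le> (norm v)\<^sup>2 * (- (w \<bullet> (hessian g p *v w)) + M * (w \<bullet> gradient g p)\<^sup>2)" by simp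
    also have "\<dots> = - ((norm v *\<^sub>R w) \<bullet> (hessian g p *v (norm v *\<^sub>R w))) + M * ((norm v *\<^sub>R w) \<bullet> gradient g p)\<^sup>2"
      by (simp add: matrix_vector_mult_scaleR power_mult_distrib power2_eq_square[of "norm v"] algebra_simps)
    finally show ?thesis
      by (simp add: v[symmetric] dot_square_norm mult.commute)
  qed simp
  define G where "G x = g x - M / 2 * (g x * g x)" for x
  have gg: "real_polynomial_function (\<lambda>x. g x * g x)"
    by (intro real_polynomial_function.intros(4) g)
  have G: "real_polynomial_function G"
    unfolding G_def[abs_def]
    by (intro real_polynomial_function_diff real_polynomial_function.intros(2,4) g)
  have H: "hessian G p $ i $ j = hessian g p $ i $ j - M * (gradient g p $ i * gradient g p $ j)" for i j
  proof -
    have d: "partial_deriv j G = (\<lambda>x. partial_deriv j g x - M * (g x * partial_deriv j g x))"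
      unfolding G_def[abs_def] partial_deriv_diff_cmult[OF g gg] partial_deriv_mult[OF g g]
      by (intro ext) (simp add: partial_deriv_diff_cmult[OF g gg, of _ "M / 2", simplified] partial_deriv_mult[OF g g])
    have gd: "real_polynomial_function (partial_deriv j g)" by (rule real_polynomial_partial_deriv[OF g])
    show ?thesis
      using \<open>g p = 0\<close>
      by (simp add: hessian_def gradient_def d partial_deriv_diff_cmult[OF gd real_polynomial_function.intros(4)[OF g gd]] partial_deriv_mult[OF g gd])
  qed
  have "c * (v \<bullet> v) \<le> - (v \<bullet> (hessian G p *v v))" for v
  proof -
    have "(v \<bullet> gradient g p)\<^sup>2 = (\<Sum>i\<in>UNIV. \<Sum>j\<in>UNIV. v $ i * v $ j * (gradient g p $ i * gradient g p $ j))"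
      unfolding inner_vec_def power2_eq_square sum_product by (simp add: mult_ac)
    then have "v \<bullet> (hessian G p *v v) = v \<bullet> (hessian g p *v v) - M * (v \<bullet> gradient g p)\<^sup>2"
      unfolding quadratic_form_eq H by (simp add: right_diff_distrib sum_subtractf sum_distrib_left mult_ac)
    then show ?thesis using bound[of v] by linarith
  qed
  moreover have "\<forall>\<^sub>F x in nhds p. g x \<ge> 0 \<longleftrightarrow> G x \<ge> 0"
  proof -
    have "\<forall>\<^sub>F x in nhds p. M / 2 * g x < 1"
      using \<open>g p = 0\<close>
      by (intro eventually_continuous_less continuous_intros continuous_real_polynomial_function g) simp
    then show ?thesis
    proof eventually_elim
      case (elim x)
      have "G x = (1 - M / 2 * g x) * g x" by (simp add: G_def algebra_simps)
      then show ?case using elim by (simp add: zero_le_mult_iff)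
    qed
  qed
  ultimately show ?thesis
    using G \<open>c > 0\<close> by blast
qed

lemma local_sdp_representation:
  fixes g :: "real ^ 'n \<Rightarrow> real"
  assumes g: "real_polynomial_function g" and "p \<in> S" and "g p \<ge> 0"
    and conc: "sos_concave g \<or> strictly_quasi_concave_on S g"
  shows "\<exists>R. sdp_representable R \<and> R \<subseteq> {x. g x \<ge> 0} \<and> (\<forall>\<^sub>F x in nhds p. g x \<ge> 0 \<longrightarrow> x \<in> R)"
proof -
  have cube_ev: "\<forall>\<^sub>F x in nhds p. \<forall>i. \<bar>x $ i - p $ i\<bar> \<le> d" if "d > 0" for d
    using eventually_nhds_ball[OF that, of p] ball_subset_cube[of p d] by (auto elim!: eventually_mono)
  consider "sos_concave g" | "g p > 0" | "g p = 0" "strictly_quasi_concave_on S g"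
    using conc \<open>g p \<ge> 0\<close> by fastforce
  then show ?thesis
  proof cases
    case 1
    then show ?thesis
      by (intro exI[of _ "{x. g x \<ge> 0}"]) (simp add: sdp_representable_sos_concave[OF g])
  next
    case 2
    have "\<forall>\<^sub>F x in nhds p. - g x < 0"
      by (intro eventually_continuous_less continuous_intros continuous_real_polynomial_function g) (use 2 in simp)
    then obtain d where "d > 0" and d: "\<And>x. \<forall>i. \<bar>x $ i - p $ i\<bar> \<le> d \<Longrightarrow> - g x < 0"
      using eventually_nhds_cube by metis
    have "{x. \<forall>i. \<bar>x $ i - p $ i\<bar> \<le> d} \<subseteq> {x. g x \<ge> 0}"
      using d by force
    moreover have "\<forall>\<^sub>F x in nhds p. g x \<ge> 0 \<longrightarrow> x \<in> {x. \<forall>i. \<bar>x $ i - p $ i\<bar> \<le> d}"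
      using cube_ev[OF \<open>d > 0\<close>] by eventually_elim simp
    ultimately show ?thesis using sdp_representable_box[of p d] by blast
  next
    case 3
    have "- (v \<bullet> (hessian g p *v v)) > 0" if "v \<noteq> 0" "v \<bullet> gradient g p = 0" for v
      using 3(2) \<open>p \<in> S\<close> that unfolding strictly_quasi_concave_on_def by blast
    then obtain G c where G: "real_polynomial_function G" and "c > 0"
      and neg: "\<And>v. c * (v \<bullet> v) \<le> - (v \<bullet> (hessian G p *v v))"
      and sgn: "\<forall>\<^sub>F x in nhds p. g x \<ge> 0 \<longleftrightarrow> G x \<ge> 0"
      using quasi_concave_local_replacement[OF g 3(1)] by blast
    obtain d0 where "d0 > 0" and d0: "\<And>d. d \<le> d0 \<Longrightarrow>
        sdp_representable ({x. \<forall>i. \<bar>x $ i - p $ i\<bar> \<le> d} \<inter> {x. G x \<ge> 0})"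
      using sdp_representable_strongly_concave_local[OF G \<open>c > 0\<close> neg] by blast
    obtain d1 where "d1 > 0" and d1: "\<And>x. \<forall>i. \<bar>x $ i - p $ i\<bar> \<le> d1 \<Longrightarrow> (g x \<ge> 0 \<longleftrightarrow> G x \<ge> 0)"
      using eventually_nhds_cube[OF sgn] by metis
    define d where "d = min d0 d1"
    let ?R = "{x. \<forall>i. \<bar>x $ i - p $ i\<bar> \<le> d} \<inter> {x. G x \<ge> 0}"
    have "d > 0" using \<open>d0 > 0\<close> \<open>d1 > 0\<close> by (simp add: d_def)
    have "?R \<subseteq> {x. g x \<ge> 0}" using d1 by (auto simp: d_def)
    moreover have "\<forall>\<^sub>F x in nhds p. g x \<ge> 0 \<longrightarrow> x \<in> ?R"
      using cube_ev[OF \<open>d > 0\<close>] sgn by eventually_elim simp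
    moreover have "sdp_representable ?R" by (rule d0) (simp add: d_def)
    ultimately show ?thesis by blast
  qed
qed

theorem theorem2:
  fixes g :: "nat \<Rightarrow> real ^ 'n \<Rightarrow> real" and m :: nat and S :: "(real ^ 'n) set"
  assumes poly: "\<And>i. i \<in> {1..m} \<Longrightarrow> real_polynomial_function (g i)"
    and S_def: "S = {x. \<forall>i\<in>{1..m}. g i x \<ge> 0}"
    and "compact S" and "convex S" and "interior S \<noteq> {}"
    and "\<And>i. i \<in> {1..m} \<Longrightarrow> sos_concave (g i) \<or> strictly_quasi_concave_on S (g i)"
  shows "sdp_representable S"
proof -
  have "\<exists>T. sdp_representable T \<and> T \<subseteq> S \<and> (\<exists>U. open U \<and> p \<in> U \<and> U \<inter> S \<subseteq> T)" if "p \<in> S" for p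
  proof -
    have "\<forall>i\<in>{1..m}. \<exists>R. sdp_representable R \<and> R \<subseteq> {x. g i x \<ge> 0} \<and>
        (\<forall>\<^sub>F x in nhds p. g i x \<ge> 0 \<longrightarrow> x \<in> R)"
      using \<open>p \<in> S\<close> S_def
      by (intro ballI local_sdp_representation[OF poly \<open>p \<in> S\<close> _ assms(6)]) auto
    from bchoice[OF this] obtain R where R: "\<And>i. i \<in> {1..m} \<Longrightarrow> sdp_representable (R i)"
      "\<And>i. i \<in> {1..m} \<Longrightarrow> R i \<subseteq> {x. g i x \<ge> 0}"
      "\<And>i. i \<in> {1..m} \<Longrightarrow> \<forall>\<^sub>F x in nhds p. g i x \<ge> 0 \<longrightarrow> x \<in> R i"
      by blast
    have "\<forall>\<^sub>F x in nhds p. \<forall>i\<in>{1..m}. g i x \<ge> 0 \<longrightarrow> x \<in> R i"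
      using R(3) by (intro eventually_ball_finite) auto
    then obtain U where U: "open U" "p \<in> U" "\<And>x. x \<in> U \<Longrightarrow> \<forall>i\<in>{1..m}. g i x \<ge> 0 \<longrightarrow> x \<in> R i"
      unfolding eventually_nhds by blast
    have "sdp_representable (\<Inter>i\<in>{1..m}. R i)"
      by (intro sdp_representable_INT R) auto
    moreover have "(\<Inter>i\<in>{1..m}. R i) \<subseteq> S" using R(2) unfolding S_def by blast
    moreover have "U \<inter> S \<subseteq> (\<Inter>i\<in>{1..m}. R i)" using U(3) unfolding S_def by blast
    ultimately show ?thesis using U(1,2) by blast
  qed
  then obtain T where T: "\<And>p. p \<in> S \<Longrightarrow> sdp_representable (T p)" "\<And>p. p \<in> S \<Longrightarrow> T p \<subseteq> S"
    and "\<And>p. p \<in> S \<Longrightarrow> \<exists>U. open U \<and> p \<in> U \<and> U \<inter> S \<subseteq> T p"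
    by metis
  then obtain U where U: "\<And>p. p \<in> S \<Longrightarrow> open (U p)" "\<And>p. p \<in> S \<Longrightarrow> p \<in> U p"
    "\<And>p. p \<in> S \<Longrightarrow> U p \<inter> S \<subseteq> T p"
    by metis
  have "S \<subseteq> (\<Union>p\<in>S. U p)" using U(2) by blast
  then obtain K where K: "K \<subseteq> S" "finite K" "S \<subseteq> (\<Union>p\<in>K. U p)"
    using compactE_image[OF \<open>compact S\<close>, of S U] U(1) by metis
  have "S \<noteq> {}" using \<open>interior S \<noteq> {}\<close> interior_subset by blast
  then have "K \<noteq> {}" using K(3) by auto
  show ?thesis
  proof (rule sdp_representable_finite_cover[OF \<open>finite K\<close> \<open>K \<noteq> {}\<close> \<open>convex S\<close> compact_imp_bounded[OF \<open>compact S\<close>]])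
    show "sdp_representable (T p)" "T p \<subseteq> S" if "p \<in> K" for p
      using T K(1) that by auto
    show "T p \<noteq> {}" if "p \<in> K" for p
      using U(2,3)[of p] K(1) that by auto
    show "S \<subseteq> (\<Union>p\<in>K. T p)"
      using K U(3) by blast
  qed
qed

end
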